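(* Let $0\le\alpha<1$, let $p\ge q\ge2$ and $n$ be integers with $p+q\le n-1$ and $n\not\equiv p+q\pmod 2$, and let $G\in\mathcal{G}_{n,p,q}$. Then $\lambda_\alpha(G)\ge\lambda_\alpha(B^1_{n,p,q})$, with equality if and only if $G\cong B^1_{n,p,q}$.
   Context: All digraphs are simple. For a digraph $G$, $A(G)$ is its adjacency matrix and $D(G)$ the diagonal matrix of outdegrees; $A_\alpha(G)=\alpha D(G)+(1-\alpha)A(G)$ and $\lambda_\alpha(G)$ is the largest modulus of an eigenvalue of $A_\alpha(G)$. A digraph is bipartite if its vertex set splits into two disjoint sets with every arc going between them. $\overleftrightarrow{K_{p,q}}$ is the complete bipartite digraph obtained from $K_{p,q}$ by replacing each edge with a pair of opposite arcs; $\mathcal{G}_{n,p,q}$ is the set of strongly connected bipartite digraphs on $n$ vertices containing $\overleftrightarrow{K_{p,q}}$ as a subdigraph. Let $\overleftrightarrow{K_{p,q}}$ have parts $V_p=\{v_1,\ldots,v_p\}$ and $V_q=\{v_{p+1},\ldots,v_{p+q}\}$, and let $v_{p+q+1},\ldots,v_n$ be new vertices. $B^1_{n,p,q}$ is obtained from $\overleftrightarrow{K_{p,q}}$ by adding the directed path $v_1v_{p+q+1}v_{p+q+2}\cdots v_nv_p$. *)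

theory Defs
  imports
    "Graph_Theory.Graph_Theory"
    "Jordan_Normal_Form.Spectral_Radius"
    "HOL-Number_Theory.Cong"
begin

text \<open>
  Simple digraphs are those of the locale \<^locale>\<open>digraph\<close> (finite, no loops, no parallel arcs;
  opposite arcs are allowed). Matrices are taken with respect to an enumeration \<open>vs\<close> of
  the vertices.
\<close>

definition adjacency_mat :: "'a list \<Rightarrow> ('a,'b) pre_digraph \<Rightarrow> real mat" where
  "adjacency_mat vs G = mat (length vs) (length vs)
     (\<lambda>(i,j). if vs ! i \<rightarrow>\<^bsub>G\<^esub> vs ! j then 1 else 0)"

definition outdegree_mat :: "'a list \<Rightarrow> ('a,'b) pre_digraph \<Rightarrow> real mat" where
  "outdegree_mat vs G = mat (length vs) (length vs)
     (\<lambda>(i,j). if i = j then real (out_degree G (vs ! i)) else 0)"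

definition A_alpha :: "real \<Rightarrow> 'a list \<Rightarrow> ('a,'b) pre_digraph \<Rightarrow> real mat" where
  "A_alpha \<alpha> vs G = \<alpha> \<cdot>\<^sub>m outdegree_mat vs G + (1 - \<alpha>) \<cdot>\<^sub>m adjacency_mat vs G"

text \<open>
  The choice of the enumeration is immaterial, see \<open>lambda_alpha_eq\<close> below.
\<close>

definition lambda_alpha :: "real \<Rightarrow> ('a,'b) pre_digraph \<Rightarrow> real" where
  "lambda_alpha \<alpha> G = spectral_radius (map_mat complex_of_real
     (A_alpha \<alpha> (SOME vs. distinct vs \<and> set vs = verts G) G))"

definition bipartite_digraph :: "('a,'b) pre_digraph \<Rightarrow> bool" where
  "bipartite_digraph G \<longleftrightarrow> (\<exists>X Y. verts G = X \<union> Y \<and> X \<inter> Y = {} \<and>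
     (\<forall>u v. u \<rightarrow>\<^bsub>G\<^esub> v \<longrightarrow> u \<in> X \<and> v \<in> Y \<or> u \<in> Y \<and> v \<in> X))"

definition bip_class :: "nat \<Rightarrow> nat \<Rightarrow> nat \<Rightarrow> ('a,'b) pre_digraph set" where
  "bip_class n p q = {G. digraph G \<and> card (verts G) = n \<and> strongly_connected G \<and>
     bipartite_digraph G \<and> (\<exists>H. subgraph H G \<and> K\<^bsub>p,q\<^esub> H)}"

text \<open>The vertex \<open>v\<^sub>i\<close> is represented by the number \<open>i\<close>.\<close>

definition K_bip :: "nat \<Rightarrow> nat \<Rightarrow> nat pair_pre_digraph" where
  "K_bip p q = \<lparr> pverts = {1..p} \<union> {p+1..p+q},
     parcs = {1..p} \<times> {p+1..p+q} \<union> {p+1..p+q} \<times> {1..p} \<rparr>"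

definition B1 :: "nat \<Rightarrow> nat \<Rightarrow> nat \<Rightarrow> nat pair_pre_digraph" where
  "B1 n p q = \<lparr> pverts = pverts (K_bip p q) \<union> {p+q+1..n},
     parcs = parcs (K_bip p q) \<union> set (vwalk_arcs (1 # [p+q+1..<n+1] @ [p])) \<rparr>"

lemma K_bip_complete_bipartite: "K\<^bsub>p,q\<^esub> (with_proj (K_bip p q))"
  unfolding complete_bipartite_digraph_pair_def K_bip_def
  by (intro conjI exI[of _ "{1..p}"] exI[of _ "{p+1..p+q}"]) auto

lemma eigenvalue_A_alpha_iff:
  assumes vs: "distinct vs" "set vs = verts G"
  shows "eigenvalue (map_mat complex_of_real (A_alpha \<alpha> vs G)) k \<longleftrightarrow>
    (\<exists>x. (\<exists>v\<in>verts G. x v \<noteq> 0) \<and>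
      (\<forall>v\<in>verts G. (\<Sum>w\<in>verts G. complex_of_real
          (\<alpha> * (if v = w then real (out_degree G v) else 0)
           + (1 - \<alpha>) * (if v \<rightarrow>\<^bsub>G\<^esub> w then 1 else 0)) * x w) = k * x v))"
    (is "?L \<longleftrightarrow> (\<exists>x. ?R x)")
proof -
  let ?n = "length vs"
  define a where "a v w = complex_of_real
          (\<alpha> * (if v = w then real (out_degree G v) else 0)
           + (1 - \<alpha>) * (if v \<rightarrow>\<^bsub>G\<^esub> w then 1 else 0))" for v w
  let ?M = "map_mat complex_of_real (A_alpha \<alpha> vs G)"
  have dim: "?M \<in> carrier_mat ?n ?n"
    by (simp add: A_alpha_def outdegree_mat_def adjacency_mat_def)
  have entry: "?M $$ (i,j) = a (vs ! i) (vs ! j)" if "i < ?n" "j < ?n" for i j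
    using that vs(1)
    by (simp add: A_alpha_def outdegree_mat_def adjacency_mat_def a_def nth_eq_iff_index_eq)
  have bij: "bij_betw ((!) vs) {0..<?n} (verts G)"
    using bij_betw_nth[OF vs(1)] vs(2) by (simp add: atLeast0LessThan)
  have mult: "(?M *\<^sub>v u) $ i = (\<Sum>w\<in>verts G. a (vs ! i) w * x w)"
    if u: "u \<in> carrier_vec ?n" "\<And>j. j < ?n \<Longrightarrow> u $ j = x (vs ! j)" and i: "i < ?n" for u x i
  proof -
    have "(?M *\<^sub>v u) $ i = (\<Sum>j = 0..<?n. ?M $$ (i,j) * u $ j)"
      using dim u(1) i by (simp add: scalar_prod_def)
    also have "\<dots> = (\<Sum>j = 0..<?n. a (vs ! i) (vs ! j) * x (vs ! j))"
      by (rule sum.cong) (use entry i u(2) in auto)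
    also have "\<dots> = (\<Sum>w\<in>verts G. a (vs ! i) w * x w)"
      by (rule sum.reindex_bij_betw[OF bij])
    finally show ?thesis .
  qed
  have key: "eigenvector ?M u k \<longleftrightarrow> ?R x"
    if u: "u \<in> carrier_vec ?n" "\<And>j. j < ?n \<Longrightarrow> u $ j = x (vs ! j)" for u x
  proof -
    have "u \<noteq> 0\<^sub>v ?n \<longleftrightarrow> (\<exists>j<?n. u $ j \<noteq> 0)"
      using u(1) by (auto simp: vec_eq_iff)
    also have "\<dots> \<longleftrightarrow> (\<exists>v\<in>verts G. x v \<noteq> 0)"
      unfolding vs(2)[symmetric] using u(2) by (auto simp: Bex_def in_set_conv_nth)
    finally have nz: "u \<noteq> 0\<^sub>v ?n \<longleftrightarrow> (\<exists>v\<in>verts G. x v \<noteq> 0)" .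
    have "?M *\<^sub>v u = k \<cdot>\<^sub>v u \<longleftrightarrow> (\<forall>i<?n. (?M *\<^sub>v u) $ i = k * u $ i)"
      using u(1) dim by (auto simp: vec_eq_iff)
    also have "\<dots> \<longleftrightarrow> (\<forall>i<?n. (\<Sum>w\<in>verts G. a (vs ! i) w * x w) = k * x (vs ! i))"
      using mult[OF u] u(2) by auto
    also have "\<dots> \<longleftrightarrow> (\<forall>v\<in>verts G. (\<Sum>w\<in>verts G. a v w * x w) = k * x v)"
      unfolding vs(2)[symmetric] by (simp add: all_set_conv_all_nth)
    finally show ?thesis
      using nz u(1) dim unfolding eigenvector_def a_def by auto
  qed
  show ?thesis
  proof
    assume ?L
    then obtain u where u: "eigenvector ?M u k" by (auto simp: eigenvalue_def)
    then have uc: "u \<in> carrier_vec ?n" using dim by (auto simp: eigenvector_def)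
    define x where "x v = u $ (the_inv_into {0..<?n} ((!) vs) v)" for v
    have "u $ j = x (vs ! j)" if "j < ?n" for j
      using that bij by (simp add: x_def the_inv_into_f_f bij_betw_def)
    from key[OF uc this] u have "?R x" by blast
    then show "\<exists>x. ?R x" by (rule exI[of _ x])
  next
    assume "\<exists>x. ?R x"
    then obtain x where x: "?R x" ..
    have "eigenvector ?M (vec ?n (\<lambda>j. x (vs ! j))) k"
      by (subst key[of _ x]) (use x in auto)
    then show ?L by (auto simp: eigenvalue_def)
  qed
qed

lemma lambda_alpha_eq:
  assumes "distinct vs" "set vs = verts G"
  shows "lambda_alpha \<alpha> G = spectral_radius (map_mat complex_of_real (A_alpha \<alpha> vs G))"
proof -
  let ?ws = "SOME vs. distinct vs \<and> set vs = verts G"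
  have ws: "distinct ?ws" "set ?ws = verts G"
    using someI[of "\<lambda>vs. distinct vs \<and> set vs = verts G" vs] assms by auto
  show ?thesis
    unfolding lambda_alpha_def spectral_radius_def spectrum_def
      eigenvalue_A_alpha_iff[OF ws] eigenvalue_A_alpha_iff[OF assms] ..
qed

end

theory Submission
  imports Defs
begin

text \<open>
  Let \<open>\<rho>\<close> be the spectral radius of \<open>B1\<close> and \<open>t = (1 - \<alpha>) / (\<rho> - \<alpha>) < 1\<close>. Its Perron vector is
  constant on each part of the biclique, except at the start of the path, and decays by the factor
  \<open>t\<close> per step of distance along the path. In \<open>G\<close>, strong connectivity gives an arc from a vertex
  \<open>v\<close> of the biclique, in the part \<open>S\<close> say, to a vertex \<open>w\<close> outside it. Weight the biclique like the
  Perron vector, with \<open>v\<close> as the start, and every other vertex \<open>u\<close> by \<open>t\<close> to the power of the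
  distance from \<open>u\<close> to \<open>S\<close>. By parity the distance from \<open>w\<close> is at most \<open>n - p - q\<close>, so this positive
  vector \<open>z\<close> satisfies \<open>A\<^sub>\<alpha> z \<ge> \<rho> z\<close>, which bounds the spectral radius of \<open>G\<close> from below. If
  equality holds then \<open>A\<^sub>\<alpha> z = \<rho> z\<close>, which leaves room for no arc beyond a single path of maximal
  length returning to \<open>S - {v}\<close>. When \<open>S\<close> is the strictly smaller part, a modified weight makes
  the inequality at \<open>v\<close> strict.
\<close>

section \<open>Spectral radii of nonnegative matrices\<close>

lemma spectral_radius_memE:
  assumes A: "A \<in> carrier_mat n n" and n_pos: "0 < n"
  obtains k u where "u \<in> carrier_vec n" "u \<noteq> 0\<^sub>v n" "A *\<^sub>v u = k \<cdot>\<^sub>v u" "spectral_radius A = norm k"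
  using spectral_radius_mem_max(1)[OF A n_pos] A
  by (auto simp: spectrum_def eigenvalue_def eigenvector_def)

lemma spectral_radius_nonneg: "A \<in> carrier_mat n n \<Longrightarrow> 0 < n \<Longrightarrow> 0 \<le> spectral_radius A"
  using spectral_radius_memE by (metis norm_ge_zero)

lemma norm_eigenvalue_le_spectral_radius:
  assumes A: "A \<in> carrier_mat n n" and n_pos: "0 < n"
    and u: "u \<in> carrier_vec n" "u \<noteq> 0\<^sub>v n" "A *\<^sub>v u = k \<cdot>\<^sub>v u"
  shows "norm k \<le> spectral_radius A"
proof (rule spectral_radius_mem_max(2)[OF A n_pos imageI])
  show "k \<in> spectrum A" using u A by (auto simp: spectrum_def eigenvalue_def eigenvector_def)
qed

lemma smult_mat_mult_vec:
  fixes A :: "'a :: comm_semiring_0 mat"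
  assumes "A \<in> carrier_mat m n" "x \<in> carrier_vec n"
  shows "(c \<cdot>\<^sub>m A) *\<^sub>v x = c \<cdot>\<^sub>v (A *\<^sub>v x)"
  using assms by (intro eq_vecI) (auto simp: scalar_prod_def sum_distrib_left mult.assoc)

lemma pow_mat_smult:
  fixes A :: "'a :: comm_semiring_1 mat"
  assumes A: "A \<in> carrier_mat n n"
  shows "(c \<cdot>\<^sub>m A) ^\<^sub>m m = c ^ m \<cdot>\<^sub>m A ^\<^sub>m m"
proof (induction m)
  case 0
  show ?case using A by (intro eq_matI) auto
next
  case (Suc m)
  have "(c \<cdot>\<^sub>m A) ^\<^sub>m Suc m = (c ^ m \<cdot>\<^sub>m A ^\<^sub>m m) * (c \<cdot>\<^sub>m A)" by (simp add: Suc.IH)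
  also have "\<dots> = c ^ Suc m \<cdot>\<^sub>m A ^\<^sub>m Suc m"
    using pow_carrier_mat[OF A, of m] A
    by (intro eq_matI) (auto simp: mult.assoc mult.left_commute)
  finally show ?case .
qed

lemma pow_mat_Suc_left:
  fixes A :: "'a :: semiring_1 mat"
  assumes A: "A \<in> carrier_mat n n"
  shows "A ^\<^sub>m Suc m = A * A ^\<^sub>m m"
proof (induction m)
  case 0
  show ?case using A by simp
next
  case (Suc m)
  have "A ^\<^sub>m Suc (Suc m) = A * A ^\<^sub>m m * A" using Suc.IH by simp
  also have "\<dots> = A * A ^\<^sub>m Suc m" using A by (simp add: assoc_mult_mat[of _ n n _ n])
  finally show ?case .
qed

lemma spectral_radius_smult_less_1:
  assumes A: "A \<in> carrier_mat n n" and n_pos: "0 < n" and r_gt: "spectral_radius A < r"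
  shows "spectral_radius (of_real (1 / r) \<cdot>\<^sub>m A) < 1"
proof -
  let ?C = "of_real (1 / r) \<cdot>\<^sub>m A"
  have C: "?C \<in> carrier_mat n n" using A by simp
  obtain k u where u: "u \<in> carrier_vec n" "u \<noteq> 0\<^sub>v n"
    and eig: "?C *\<^sub>v u = k \<cdot>\<^sub>v u" and k: "spectral_radius ?C = norm k"
    using spectral_radius_memE[OF C n_pos] .
  have r_pos: "0 < r" using spectral_radius_nonneg[OF A n_pos] r_gt by simp
  have "A = of_real r \<cdot>\<^sub>m ?C" using r_pos by (intro eq_matI) auto
  then have "A *\<^sub>v u = of_real r \<cdot>\<^sub>v (?C *\<^sub>v u)" by (metis smult_mat_mult_vec C u(1))
  then have "A *\<^sub>v u = (of_real r * k) \<cdot>\<^sub>v u" unfolding eig by (simp add: smult_smult_assoc)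
  then have "norm (of_real r * k) < r"
    using norm_eigenvalue_le_spectral_radius[OF A n_pos u] r_gt by fastforce
  then show ?thesis using r_pos k by (simp add: norm_mult)
qed

lemma pow_mat_norm_bound:
  assumes A: "A \<in> carrier_mat n n" and n_pos: "0 < n" and r_gt: "0 < r" "spectral_radius A < r"
  shows "\<exists>c. \<forall>m. norm_bound (A ^\<^sub>m m) (c * r ^ m)"
proof -
  have C: "of_real (1 / r) \<cdot>\<^sub>m A \<in> carrier_mat n n" using A by simp
  obtain c where c_bound: "norm_bound ((of_real (1 / r) \<cdot>\<^sub>m A) ^\<^sub>m m) c" for m
    using spectral_radius_jnf_norm_bound_less_1_upper_triangular
      [OF C spectral_radius_smult_less_1[OF A n_pos r_gt(2)]] by auto
  have "norm_bound (A ^\<^sub>m m) (c * r ^ m)" for m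
    unfolding norm_bound_def carrier_matD[OF pow_carrier_mat[OF A]]
  proof (intro allI impI)
    fix i j assume ij: "i < n" "j < n"
    have "norm ((of_real (1 / r) ^ m \<cdot>\<^sub>m A ^\<^sub>m m) $$ (i,j)) \<le> c"
      using c_bound[of m] ij
      unfolding pow_mat_smult[OF A, symmetric] norm_bound_def carrier_matD[OF pow_carrier_mat[OF C]]
      by blast
    then have "norm ((A ^\<^sub>m m) $$ (i,j)) / r ^ m \<le> c"
      using A ij r_gt by (simp add: norm_mult norm_power norm_divide power_divide)
    then show "norm ((A ^\<^sub>m m) $$ (i,j)) \<le> c * r ^ m" using r_gt by (simp add: divide_le_eq)
  qed
  then show ?thesis by blast
qed

lemma pow_mat_mult_vec_ge:
  fixes A :: "'a :: linordered_idom mat"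
  assumes A: "A \<in> carrier_mat n n" and nonneg: "\<And>i j. i < n \<Longrightarrow> j < n \<Longrightarrow> 0 \<le> A $$ (i,j)"
    and z: "z \<in> carrier_vec n" and \<rho>_nonneg: "0 \<le> \<rho>"
    and sub: "\<And>i. i < n \<Longrightarrow> \<rho> * z $ i \<le> (A *\<^sub>v z) $ i"
    and i: "i < n"
  shows "\<rho> ^ m * z $ i \<le> (A ^\<^sub>m m *\<^sub>v z) $ i"
  using i
proof (induction m arbitrary: i)
  case 0
  then show ?case using A z by simp
next
  case (Suc m)
  have Am: "A ^\<^sub>m m \<in> carrier_mat n n" by (rule pow_carrier_mat[OF A])
  have "\<rho> ^ Suc m * z $ i = \<rho> ^ m * (\<rho> * z $ i)" by simp
  also have "\<dots> \<le> \<rho> ^ m * (A *\<^sub>v z) $ i"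
    using sub[OF Suc.prems] \<rho>_nonneg by (intro mult_left_mono) auto
  also have "\<dots> = (\<Sum>j = 0..<n. A $$ (i,j) * (\<rho> ^ m * z $ j))"
    using A z Suc.prems by (simp add: scalar_prod_def sum_distrib_left mult.left_commute)
  also have "\<dots> \<le> (\<Sum>j = 0..<n. A $$ (i,j) * (A ^\<^sub>m m *\<^sub>v z) $ j)"
    using Suc nonneg by (intro sum_mono mult_left_mono) auto
  also have "\<dots> = (A *\<^sub>v (A ^\<^sub>m m *\<^sub>v z)) $ i"
    using A Am z Suc.prems by (simp add: scalar_prod_def)
  also have "A *\<^sub>v (A ^\<^sub>m m *\<^sub>v z) = A ^\<^sub>m Suc m *\<^sub>v z"
    unfolding pow_mat_Suc_left[OF A] by (rule assoc_mult_mat_vec[OF A Am z, symmetric])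
  finally show ?case .
qed

text \<open>
  If the spectral radius were below \<open>r < \<rho>\<close>, then \<open>A ^ m\<close> would be \<open>O(r ^ m)\<close>, yet it stretches \<open>z\<close>
  by \<open>\<rho> ^ m\<close>.
\<close>

lemma spectral_radius_nonneg_mat_ge:
  fixes A :: "real mat"
  assumes A: "A \<in> carrier_mat n n" and nonneg: "\<And>i j. i < n \<Longrightarrow> j < n \<Longrightarrow> 0 \<le> A $$ (i,j)"
    and z: "z \<in> carrier_vec n" "\<And>i. i < n \<Longrightarrow> 0 \<le> z $ i" and i: "i < n" "0 < z $ i"
    and sub: "\<And>i. i < n \<Longrightarrow> \<rho> * z $ i \<le> (A *\<^sub>v z) $ i"
  shows "\<rho> \<le> spectral_radius (map_mat complex_of_real A)"
proof (rule ccontr)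
  let ?A = "map_mat complex_of_real A"
  assume "\<not> ?thesis"
  then obtain r where r_between: "spectral_radius ?A < r" "r < \<rho>"
    using dense[of "spectral_radius ?A" \<rho>] by (auto simp: not_le)
  have A': "?A \<in> carrier_mat n n" and n_pos: "0 < n" using A i by auto
  have r_pos: "0 < r" using spectral_radius_nonneg[OF A' n_pos] r_between by simp
  obtain c where c_bound: "norm_bound (?A ^\<^sub>m m) (c * r ^ m)" for m
    using pow_mat_norm_bound[OF A' n_pos r_pos r_between(1)] by blast
  have bounded: "(\<rho> / r) ^ m \<le> (\<Sum>j = 0..<n. c * z $ j) / z $ i" for m
  proof -
    have "\<rho> ^ m * z $ i \<le> (A ^\<^sub>m m *\<^sub>v z) $ i"
      using r_between r_pos by (intro pow_mat_mult_vec_ge[OF A nonneg z(1) _ sub i(1)]) auto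
    also have "\<dots> = (\<Sum>j = 0..<n. (A ^\<^sub>m m) $$ (i,j) * z $ j)"
      using A z(1) i(1) by (simp add: scalar_prod_def)
    also have "\<dots> \<le> (\<Sum>j = 0..<n. c * r ^ m * z $ j)"
    proof (intro sum_mono mult_right_mono)
      fix j assume "j \<in> {0..<n}"
      then have "norm (map_mat complex_of_real (A ^\<^sub>m m) $$ (i,j)) \<le> c * r ^ m"
        using c_bound[of m] i(1) A
        unfolding of_real_hom.mat_hom_pow[OF A, symmetric] norm_bound_def by simp
      then show "(A ^\<^sub>m m) $$ (i,j) \<le> c * r ^ m" using \<open>j \<in> {0..<n}\<close> i(1) A by simp
    qed (use z in auto)
    also have "\<dots> = r ^ m * (\<Sum>j = 0..<n. c * z $ j)"
      by (simp add: sum_distrib_left mult.left_commute mult.assoc)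
    finally have "(\<rho> / r) ^ m * z $ i \<le> (\<Sum>j = 0..<n. c * z $ j)"
      using r_pos by (simp add: power_divide divide_le_eq mult.commute)
    then show ?thesis using i(2) by (simp add: le_divide_eq)
  qed
  have "1 < \<rho> / r" using r_between r_pos by simp
  then show False using real_arch_pow bounded not_le by blast
qed

lemma spectral_radius_nonneg_mat_le:
  fixes A :: "real mat"
  assumes A: "A \<in> carrier_mat n n" and nonneg: "\<And>i j. i < n \<Longrightarrow> j < n \<Longrightarrow> 0 \<le> A $$ (i,j)"
    and n_pos: "0 < n" and x: "x \<in> carrier_vec n" "\<And>i. i < n \<Longrightarrow> 0 < x $ i"
    and super: "\<And>i. i < n \<Longrightarrow> (A *\<^sub>v x) $ i \<le> \<rho> * x $ i"
  shows "spectral_radius (map_mat complex_of_real A) \<le> \<rho>"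
proof -
  let ?A = "map_mat complex_of_real A"
  have A': "?A \<in> carrier_mat n n" using A by simp
  obtain k u where u: "u \<in> carrier_vec n" "u \<noteq> 0\<^sub>v n"
    and eig: "?A *\<^sub>v u = k \<cdot>\<^sub>v u" and k: "spectral_radius ?A = norm k"
    using spectral_radius_memE[OF A' n_pos] .
  define M where "M = Max ((\<lambda>i. norm (u $ i) / x $ i) ` {..<n})"
  have "M \<in> (\<lambda>i. norm (u $ i) / x $ i) ` {..<n}" unfolding M_def
    using n_pos by (intro Max_in) auto
  then obtain i where i: "i < n" and norm_u_i: "norm (u $ i) = M * x $ i" using x(2) by fastforce
  have le_M: "norm (u $ j) \<le> M * x $ j" if "j < n" for j
  proof -
    have "norm (u $ j) / x $ j \<le> M" unfolding M_def using that by (intro Max_ge) auto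
    then show ?thesis using x(2)[OF that] by (simp add: divide_le_eq)
  qed
  obtain j where "j < n" "u $ j \<noteq> 0" using u by (auto simp: vec_eq_iff)
  then have "0 < M * x $ j" using le_M[of j] by (metis less_le_trans zero_less_norm_iff)
  then have M_pos: "0 < M" using x(2)[OF \<open>j < n\<close>] by (simp add: zero_less_mult_iff)
  have "norm k * norm (u $ i) = norm ((?A *\<^sub>v u) $ i)" using eig i u by (simp add: norm_mult)
  also have "\<dots> = norm (\<Sum>j = 0..<n. of_real (A $$ (i,j)) * u $ j)"
    using A u i by (simp add: scalar_prod_def)
  also have "\<dots> \<le> (\<Sum>j = 0..<n. A $$ (i,j) * (M * x $ j))"
    using nonneg i le_M by (intro sum_norm_le) (auto simp: norm_mult intro!: mult_left_mono)
  also have "\<dots> = M * (A *\<^sub>v x) $ i"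
    using A x i by (simp add: scalar_prod_def sum_distrib_left mult.left_commute)
  also have "\<dots> \<le> M * (\<rho> * x $ i)" using super[OF i] M_pos by (intro mult_left_mono) auto
  also have "\<dots> = \<rho> * norm (u $ i)" by (simp add: norm_u_i)
  finally show ?thesis using norm_u_i M_pos x(2)[OF i] by (simp add: k)
qed

section \<open>The matrix \<open>A\<^sub>\<alpha>\<close> as an operator on vertex functions\<close>

abbreviation out_neighbours :: "('a,'b) pre_digraph \<Rightarrow> 'a \<Rightarrow> 'a set" where
  "out_neighbours G v \<equiv> arcs_ends G `` {v}"

definition alpha_sum :: "real \<Rightarrow> ('a \<Rightarrow> real) \<Rightarrow> 'a \<Rightarrow> 'a set \<Rightarrow> real" where
  "alpha_sum \<alpha> x v N = (\<Sum>w\<in>N. \<alpha> * x v + (1 - \<alpha>) * x w)"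

definition A_alpha_op :: "real \<Rightarrow> ('a,'b) pre_digraph \<Rightarrow> ('a \<Rightarrow> real) \<Rightarrow> 'a \<Rightarrow> real" where
  "A_alpha_op \<alpha> G x v = alpha_sum \<alpha> x v (out_neighbours G v)"

lemma alpha_sum_eq: "alpha_sum \<alpha> x v N = \<alpha> * card N * x v + (1 - \<alpha>) * sum x N"
  by (simp add: alpha_sum_def sum.distrib sum_distrib_left)

lemma alpha_sum_singleton: "alpha_sum \<alpha> x v {w} = \<alpha> * x v + (1 - \<alpha>) * x w"
  by (simp add: alpha_sum_def)

lemma alpha_sum_mono_set:
  assumes "0 \<le> \<alpha>" "\<alpha> < 1" "finite N'" "N \<subseteq> N'" "0 \<le> x v" "\<And>w. w \<in> N' \<Longrightarrow> 0 \<le> x w"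
  shows "alpha_sum \<alpha> x v N \<le> alpha_sum \<alpha> x v N'"
  unfolding alpha_sum_def using assms by (intro sum_mono2) auto

lemma alpha_sum_strict_mono_set:
  assumes "0 \<le> \<alpha>" "\<alpha> < 1" "finite N'" "N \<subset> N'" "0 \<le> x v" "\<And>w. w \<in> N' \<Longrightarrow> 0 < x w"
  shows "alpha_sum \<alpha> x v N < alpha_sum \<alpha> x v N'"
proof -
  obtain w where w: "w \<in> N' - N" using assms(4) by blast
  have "0 < \<alpha> * x v + (1 - \<alpha>) * x w'" if "w' \<in> N'" for w'
    using assms that by (intro add_nonneg_pos mult_pos_pos) auto
  then show ?thesis
    unfolding alpha_sum_def using assms(3,4) w
    by (intro sum_strict_mono2[of N' N w]) (auto intro: less_imp_le)
qed

lemma A_alpha_op_scale: "A_alpha_op \<alpha> G (\<lambda>v. c * x v) v = c * A_alpha_op \<alpha> G x v"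
  by (simp add: A_alpha_op_def alpha_sum_def sum_distrib_left algebra_simps)

lemma A_alpha_op_sum:
  "A_alpha_op \<alpha> G (\<lambda>v. \<Sum>i\<in>I. x i v) v = (\<Sum>i\<in>I. A_alpha_op \<alpha> G (x i) v)"
  unfolding A_alpha_op_def alpha_sum_def
  by (subst sum.swap) (simp add: sum.distrib sum_distrib_left)

lemma A_alpha_carrier: "A_alpha \<alpha> vs G \<in> carrier_mat (length vs) (length vs)"
  by (simp add: A_alpha_def outdegree_mat_def adjacency_mat_def)

lemma A_alpha_index:
  assumes "i < length vs" "j < length vs"
  shows "A_alpha \<alpha> vs G $$ (i,j) = \<alpha> * (if i = j then real (out_degree G (vs ! i)) else 0)
    + (1 - \<alpha>) * (if vs ! i \<rightarrow>\<^bsub>G\<^esub> vs ! j then 1 else 0)"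
  using assms by (simp add: A_alpha_def outdegree_mat_def adjacency_mat_def)

lemma (in wf_digraph) strongly_connected_exit:
  assumes strong: "strongly_connected G" and A: "A \<subset> verts G" "A \<noteq> {}"
  shows "\<exists>a\<in>A. \<exists>c. c \<notin> A \<and> a \<rightarrow> c"
proof (rule ccontr)
  assume closed: "\<not> ?thesis"
  obtain u x where u: "u \<in> A" and x: "x \<in> verts G" "x \<notin> A" using A by blast
  then have "u \<rightarrow>\<^sup>* x" using strong A(1) by (auto simp: strongly_connected_def)
  then have "x \<in> A" by (induction rule: reachable_induct) (use u closed in auto)
  then show False using x(2) by contradiction
qed

context digraph
begin

lemma finite_out_neighbours [simp]: "finite (out_neighbours G v)"
  by (rule finite_subset[OF _ finite_verts]) (use adj_in_verts in auto)

lemma bij_betw_arc_to_ends: "bij_betw (arc_to_ends G) (arcs G) (arcs_ends G)"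
  using no_multi_arcs by (auto simp: bij_betw_def arcs_ends_def intro: inj_onI)

lemma out_degree_eq_card: "out_degree G v = card (out_neighbours G v)"
proof -
  have "bij_betw (head G) (out_arcs G v) (out_neighbours G v)"
    unfolding bij_betw_def
  proof
    show "inj_on (head G) (out_arcs G v)"
      by (intro inj_onI no_multi_arcs) (auto simp: arc_to_ends_def)
    show "head G ` out_arcs G v = out_neighbours G v"
      by (auto simp: arcs_ends_conv)
  qed
  then show ?thesis unfolding out_degree_def by (rule bij_betw_same_card)
qed

lemma A_alpha_mult_vec:
  assumes vs: "distinct vs" "set vs = verts G" and i: "i < length vs"
  shows "(A_alpha \<alpha> vs G *\<^sub>v vec (length vs) (\<lambda>i. x (vs ! i))) $ i = A_alpha_op \<alpha> G x (vs ! i)"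
proof -
  let ?v = "vs ! i" and ?n = "length vs"
  have adjacency_part:
    "(\<Sum>j = 0..<?n. if ?v \<rightarrow> vs ! j then x (vs ! j) else 0) = sum x (out_neighbours G ?v)"
  proof -
    have "bij_betw ((!) vs) {0..<?n} (verts G)"
      using bij_betw_nth[OF vs(1)] vs(2) by (simp add: atLeast0LessThan)
    then have "(\<Sum>j = 0..<?n. if ?v \<rightarrow> vs ! j then x (vs ! j) else 0)
        = (\<Sum>w\<in>verts G. if w \<in> out_neighbours G ?v then x w else 0)"
      by (simp add: sum.reindex_bij_betw[symmetric])
    also have "\<dots> = sum x (verts G \<inter> out_neighbours G ?v)"
      by (rule sum.inter_restrict[symmetric]) simp
    also have "verts G \<inter> out_neighbours G ?v = out_neighbours G ?v"
      using adj_in_verts by auto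
    finally show ?thesis .
  qed
  have "(A_alpha \<alpha> vs G *\<^sub>v vec ?n (\<lambda>i. x (vs ! i))) $ i
      = (\<Sum>j = 0..<?n. A_alpha \<alpha> vs G $$ (i,j) * x (vs ! j))"
    using i A_alpha_carrier[of \<alpha> vs G] by (simp add: scalar_prod_def)
  also have "\<dots> = (\<Sum>j = 0..<?n. (if j = i then \<alpha> * out_degree G ?v * x ?v else 0)
      + (1 - \<alpha>) * (if ?v \<rightarrow> vs ! j then x (vs ! j) else 0))"
    using i by (intro sum.cong) (auto simp: A_alpha_index algebra_simps)
  also have "\<dots> = \<alpha> * out_degree G ?v * x ?v + (1 - \<alpha>) * sum x (out_neighbours G ?v)"
    using i by (simp add: sum.distrib adjacency_part[symmetric] sum_distrib_left)
  finally show ?thesis by (simp add: A_alpha_op_def alpha_sum_eq out_degree_eq_card)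
qed

lemma A_alpha_op_mono:
  assumes "0 \<le> \<alpha>" "\<alpha> < 1" "\<And>w. w \<in> verts G \<Longrightarrow> x w \<le> y w" "v \<in> verts G"
  shows "A_alpha_op \<alpha> G x v \<le> A_alpha_op \<alpha> G y v"
  unfolding A_alpha_op_def alpha_sum_def using assms adj_in_verts
  by (intro sum_mono add_mono mult_left_mono) auto

lemma A_alpha_op_strict_mono:
  assumes "0 \<le> \<alpha>" "\<alpha> < 1" "\<And>w. w \<in> verts G \<Longrightarrow> x w \<le> y w" and vw: "v \<rightarrow> w" "x w < y w"
  shows "A_alpha_op \<alpha> G x v < A_alpha_op \<alpha> G y v"
  unfolding A_alpha_op_def alpha_sum_def
proof (rule sum_strict_mono_ex1)
  show "\<forall>u\<in>out_neighbours G v. \<alpha> * x v + (1 - \<alpha>) * x u \<le> \<alpha> * y v + (1 - \<alpha>) * y u"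
    using assms adj_in_verts by (intro ballI add_mono mult_left_mono) auto
  have "\<alpha> * x v + (1 - \<alpha>) * x w < \<alpha> * y v + (1 - \<alpha>) * y w"
    using assms adj_in_verts[OF vw(1)]
    by (intro add_le_less_mono mult_left_mono mult_strict_left_mono) auto
  then show "\<exists>u\<in>out_neighbours G v. \<alpha> * x v + (1 - \<alpha>) * x u < \<alpha> * y v + (1 - \<alpha>) * y u"
    using vw(1) by blast
qed simp

definition subsolution :: "real \<Rightarrow> real \<Rightarrow> ('a \<Rightarrow> real) \<Rightarrow> bool" where
  "subsolution \<alpha> \<rho> z \<longleftrightarrow> (\<forall>v\<in>verts G. 0 < z v \<and> \<rho> * z v \<le> A_alpha_op \<alpha> G z v)"

lemma lambda_alpha_ge_subsolution:
  assumes \<alpha>_bounds: "0 \<le> \<alpha>" "\<alpha> < 1" and nonempty: "verts G \<noteq> {}" and z: "subsolution \<alpha> \<rho> z"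
  shows "\<rho> \<le> lambda_alpha \<alpha> G"
proof -
  obtain vs where vs: "distinct vs" "set vs = verts G"
    using finite_distinct_list[OF finite_verts] by auto
  have vs_verts: "vs ! i \<in> verts G" if "i < length vs" for i using that vs(2) nth_mem by blast
  have "0 < length vs" using vs nonempty by auto
  then show ?thesis
    unfolding lambda_alpha_eq[OF vs] using \<alpha>_bounds z vs_verts
    by (intro spectral_radius_nonneg_mat_ge
        [OF A_alpha_carrier, where z = "vec (length vs) (\<lambda>i. z (vs ! i))" and i = 0])
      (auto simp: A_alpha_index A_alpha_mult_vec[OF vs] subsolution_def less_imp_le
        simp del: index_mult_mat_vec)
qed

lemma lambda_alpha_leI:
  assumes \<alpha>_bounds: "0 \<le> \<alpha>" "\<alpha> < 1" and nonempty: "verts G \<noteq> {}"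
    and pos: "\<And>v. v \<in> verts G \<Longrightarrow> 0 < x v"
    and super: "\<And>v. v \<in> verts G \<Longrightarrow> A_alpha_op \<alpha> G x v \<le> \<rho> * x v"
  shows "lambda_alpha \<alpha> G \<le> \<rho>"
proof -
  obtain vs where vs: "distinct vs" "set vs = verts G"
    using finite_distinct_list[OF finite_verts] by auto
  have vs_verts: "vs ! i \<in> verts G" if "i < length vs" for i using that vs(2) nth_mem by blast
  have "0 < length vs" using vs nonempty by auto
  then show ?thesis
    unfolding lambda_alpha_eq[OF vs] using \<alpha>_bounds pos super vs_verts
    by (intro spectral_radius_nonneg_mat_le
        [OF A_alpha_carrier, where x = "vec (length vs) (\<lambda>i. x (vs ! i))"])
      (auto simp: A_alpha_index A_alpha_mult_vec[OF vs] simp del: index_mult_mat_vec)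
qed

lemma lambda_alpha_eqI:
  assumes "0 \<le> \<alpha>" "\<alpha> < 1" "verts G \<noteq> {}" "\<And>v. v \<in> verts G \<Longrightarrow> 0 < x v"
    and "\<And>v. v \<in> verts G \<Longrightarrow> A_alpha_op \<alpha> G x v = \<rho> * x v"
  shows "lambda_alpha \<alpha> G = \<rho>"
proof (rule antisym)
  show "lambda_alpha \<alpha> G \<le> \<rho>" using assms by (intro lambda_alpha_leI[of \<alpha> x \<rho>]) auto
  have "subsolution \<alpha> \<rho> x" using assms by (simp add: subsolution_def)
  then show "\<rho> \<le> lambda_alpha \<alpha> G" using assms by (intro lambda_alpha_ge_subsolution)
qed

lemma lambda_alpha_gt_strict_subsolution:
  assumes \<alpha>_bounds: "0 \<le> \<alpha>" "\<alpha> < 1" and nonempty: "verts G \<noteq> {}"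
    and pos: "\<And>v. v \<in> verts G \<Longrightarrow> 0 < z v"
    and strict: "\<And>v. v \<in> verts G \<Longrightarrow> \<rho> * z v < A_alpha_op \<alpha> G z v"
  shows "\<rho> < lambda_alpha \<alpha> G"
proof -
  define \<mu> where "\<mu> = Min ((\<lambda>v. A_alpha_op \<alpha> G z v / z v) ` verts G)"
  have "\<mu> \<in> (\<lambda>v. A_alpha_op \<alpha> G z v / z v) ` verts G" unfolding \<mu>_def
    using nonempty by (intro Min_in) auto
  then have "\<rho> < \<mu>" using strict pos by (auto simp: less_divide_eq)
  moreover have "subsolution \<alpha> \<mu> z"
    unfolding subsolution_def
  proof (intro ballI conjI pos)
    fix v assume v: "v \<in> verts G"
    have "\<mu> \<le> A_alpha_op \<alpha> G z v / z v" unfolding \<mu>_def using v by (intro Min_le) auto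
    then show "\<mu> * z v \<le> A_alpha_op \<alpha> G z v" using pos[OF v] by (simp add: le_divide_eq)
  qed
  then have "\<mu> \<le> lambda_alpha \<alpha> G" by (rule lambda_alpha_ge_subsolution[OF \<alpha>_bounds nonempty])
  ultimately show ?thesis by simp
qed

lemma subsolution_A_alpha_op:
  assumes \<alpha>_bounds: "0 \<le> \<alpha>" "\<alpha> < 1" and \<rho>_pos: "0 < \<rho>" and z: "subsolution \<alpha> \<rho> z"
  shows "subsolution \<alpha> \<rho> (A_alpha_op \<alpha> G z)"
  unfolding subsolution_def
proof (intro ballI conjI)
  fix v assume v: "v \<in> verts G"
  have "0 < \<rho> * z v" using z \<rho>_pos v by (simp add: subsolution_def)
  then show "0 < A_alpha_op \<alpha> G z v" using z v by (fastforce simp: subsolution_def)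
  have "A_alpha_op \<alpha> G (\<lambda>v. \<rho> * z v) v \<le> A_alpha_op \<alpha> G (A_alpha_op \<alpha> G z) v"
    using z by (intro A_alpha_op_mono[OF \<alpha>_bounds _ v]) (simp add: subsolution_def)
  then show "\<rho> * A_alpha_op \<alpha> G z v \<le> A_alpha_op \<alpha> G (A_alpha_op \<alpha> G z) v"
    by (simp add: A_alpha_op_scale)
qed

lemma subsolution_strict_at_reachable:
  assumes \<alpha>_bounds: "0 \<le> \<alpha>" "\<alpha> < 1" and \<rho>_pos: "0 < \<rho>"
    and z: "subsolution \<alpha> \<rho> z" "\<rho> * z v\<^sub>0 < A_alpha_op \<alpha> G z v\<^sub>0"
    and v: "v \<rightarrow>\<^sup>* v\<^sub>0"
  shows "\<exists>z'. subsolution \<alpha> \<rho> z' \<and> \<rho> * z' v < A_alpha_op \<alpha> G z' v"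
  using v
proof (induction rule: converse_reachable_induct)
  case base
  then show ?case using z by blast
next
  case (step v w)
  then obtain z' where z': "subsolution \<alpha> \<rho> z'" "\<rho> * z' w < A_alpha_op \<alpha> G z' w" by blast
  have "A_alpha_op \<alpha> G (\<lambda>u. \<rho> * z' u) v < A_alpha_op \<alpha> G (A_alpha_op \<alpha> G z') v"
    using z'
    by (intro A_alpha_op_strict_mono[OF \<alpha>_bounds _ step.hyps(1)]) (auto simp: subsolution_def)
  then show ?case
    using subsolution_A_alpha_op[OF \<alpha>_bounds \<rho>_pos z'(1)] by (auto simp: A_alpha_op_scale)
qed

text \<open>
  Applying \<open>A\<^sub>\<alpha>\<close> carries strictness from a vertex to its in-neighbours, and a sum of
  subsolutions is strict wherever one of the summands is.
\<close>

lemma lambda_alpha_gt_subsolution: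
  assumes \<alpha>_bounds: "0 \<le> \<alpha>" "\<alpha> < 1" and strong: "strongly_connected G" and \<rho>_pos: "0 < \<rho>"
    and z: "subsolution \<alpha> \<rho> z" and v\<^sub>0: "v\<^sub>0 \<in> verts G" "\<rho> * z v\<^sub>0 < A_alpha_op \<alpha> G z v\<^sub>0"
  shows "\<rho> < lambda_alpha \<alpha> G"
proof -
  have "\<exists>z'. subsolution \<alpha> \<rho> z' \<and> \<rho> * z' v < A_alpha_op \<alpha> G z' v" if "v \<in> verts G" for v
    using subsolution_strict_at_reachable[OF \<alpha>_bounds \<rho>_pos z v\<^sub>0(2)] strong that v\<^sub>0(1)
    by (simp add: strongly_connected_def)
  then obtain Z where Z: "\<And>v. v \<in> verts G \<Longrightarrow> subsolution \<alpha> \<rho> (Z v)"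
    "\<And>v. v \<in> verts G \<Longrightarrow> \<rho> * Z v v < A_alpha_op \<alpha> G (Z v) v"
    by metis
  show ?thesis
  proof (rule lambda_alpha_gt_strict_subsolution[OF \<alpha>_bounds, of "\<lambda>v. \<Sum>u\<in>verts G. Z u v"])
    show nonempty: "verts G \<noteq> {}" using v\<^sub>0 by auto
    fix v assume v: "v \<in> verts G"
    show "0 < (\<Sum>u\<in>verts G. Z u v)"
      using Z(1) v nonempty by (intro sum_pos) (auto simp: subsolution_def)
    have "(\<Sum>u\<in>verts G. \<rho> * Z u v) < (\<Sum>u\<in>verts G. A_alpha_op \<alpha> G (Z u) v)"
      using Z v by (intro sum_strict_mono_ex1) (auto simp: subsolution_def)
    then show "\<rho> * (\<Sum>u\<in>verts G. Z u v) < A_alpha_op \<alpha> G (\<lambda>v. \<Sum>u\<in>verts G. Z u v) v"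
      by (simp add: A_alpha_op_sum sum_distrib_left)
  qed
qed

end

section \<open>Isomorphic digraphs\<close>

lemma lambda_alpha_iso:
  assumes G: "digraph G" and iso: "digraph_iso G H"
  shows "lambda_alpha \<alpha> H = lambda_alpha \<alpha> G"
proof -
  interpret digraph G by fact
  obtain hom where hom: "digraph_isomorphism hom" and H: "H = app_iso hom G"
    using iso unfolding digraph_iso_def by blast
  let ?f = "iso_verts hom"
  obtain vs where vs: "distinct vs" "set vs = verts G"
    using finite_distinct_list[OF finite_verts] by auto
  have ws: "distinct (map ?f vs)" "set (map ?f vs) = verts H"
    using vs digraph_isomorphism_inj_on_verts[OF hom] by (auto simp: H distinct_map)
  have adj: "?f u \<rightarrow>\<^bsub>H\<^esub> ?f v \<longleftrightarrow> u \<rightarrow>\<^bsub>G\<^esub> v" if "u \<in> verts G" "v \<in> verts G" for u v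
  proof -
    have "?f u \<rightarrow>\<^bsub>H\<^esub> ?f v \<longleftrightarrow> (\<exists>u' v'. u' \<rightarrow>\<^bsub>G\<^esub> v' \<and> ?f u = ?f u' \<and> ?f v = ?f v')"
      unfolding H arcs_ends_app_iso_eq[OF hom] by auto
    then show ?thesis using that iso_verts_eq_iff[OF hom] adj_in_verts by metis
  qed
  have vs_verts: "vs ! i \<in> verts G" if "i < length vs" for i using that vs(2) nth_mem by blast
  have "A_alpha \<alpha> (map ?f vs) H = A_alpha \<alpha> vs G"
  proof (rule eq_matI)
    fix i j assume "i < dim_row (A_alpha \<alpha> vs G)" "j < dim_col (A_alpha \<alpha> vs G)"
    then have ij: "i < length vs" "j < length vs" using A_alpha_carrier[of \<alpha> vs G] by auto
    have "out_degree H (?f (vs ! i)) = out_degree G (vs ! i)"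
      unfolding H by (rule out_degree_app_iso_eq[OF hom vs_verts[OF ij(1)]])
    then show "A_alpha \<alpha> (map ?f vs) H $$ (i,j) = A_alpha \<alpha> vs G $$ (i,j)"
      using ij by (auto simp: A_alpha_index adj vs_verts)
  qed (use A_alpha_carrier[of \<alpha> vs G] A_alpha_carrier[of \<alpha> "map ?f vs" H] in auto)
  then show ?thesis unfolding lambda_alpha_eq[OF vs] lambda_alpha_eq[OF ws] by simp
qed

lemma digraph_isoI:
  assumes G: "digraph G" and H: "digraph H" and bij: "bij_betw f (verts G) (verts H)"
    and neighbours: "\<And>u. u \<in> verts G \<Longrightarrow> f ` out_neighbours G u = out_neighbours H (f u)"
  shows "digraph_iso G H"
proof -
  interpret G: digraph G by fact
  interpret H: digraph H by fact
  have inj: "inj_on f (verts G)" by (rule bij_betw_imp_inj_on[OF bij])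
  have ends: "bij_betw (map_prod f f) (arcs_ends G) (arcs_ends H)"
  proof (rule bij_betw_imageI)
    show "inj_on (map_prod f f) (arcs_ends G)"
      by (rule inj_on_subset[OF map_prod_inj_on[OF inj inj]]) (use G.adj_in_verts in auto)
    show "map_prod f f ` arcs_ends G = arcs_ends H"
    proof (intro equalityI subrelI)
      fix x y assume "(x, y) \<in> map_prod f f ` arcs_ends G"
      then obtain u u' where u: "u \<rightarrow>\<^bsub>G\<^esub> u'" "x = f u" "y = f u'" by auto
      then have "y \<in> f ` out_neighbours G u" by blast
      then show "x \<rightarrow>\<^bsub>H\<^esub> y" using neighbours[of u] u G.adj_in_verts by auto
    next
      fix x y assume xy: "x \<rightarrow>\<^bsub>H\<^esub> y"
      then obtain u where u: "u \<in> verts G" "x = f u"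
        using H.adj_in_verts(1) bij_betw_imp_surj_on[OF bij] by (metis imageE)
      then have "y \<in> f ` out_neighbours G u" using xy neighbours by blast
      then show "(x, y) \<in> map_prod f f ` arcs_ends G" using u(2) by auto
    qed
  qed
  define g where "g = inv_into (arcs H) (arc_to_ends H) \<circ> (map_prod f f \<circ> arc_to_ends G)"
  note arcs_to_ends = bij_betw_trans[OF G.bij_betw_arc_to_ends ends]
  have g: "bij_betw g (arcs G) (arcs H)"
    unfolding g_def
    by (rule bij_betw_trans[OF arcs_to_ends bij_betw_inv_into[OF H.bij_betw_arc_to_ends]])
  have "arc_to_ends H (g e) = map_prod f f (arc_to_ends G e)" if "e \<in> arcs G" for e
    using bij_betw_inv_into_right[OF H.bij_betw_arc_to_ends] bij_betw_apply[OF arcs_to_ends that]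
    by (simp add: g_def)
  then show ?thesis
    unfolding digraph_iso_def pre_digraph.digraph_isomorphism_def
    using inj bij g G.wf_digraph
    by (intro exI[of _ "\<lparr>iso_verts = f, iso_arcs = g, iso_head = head H, iso_tail = tail H\<rparr>"])
      (auto simp: app_iso_def bij_betw_def arc_to_ends_def)
qed

section \<open>Perron weights of a biclique with an ear\<close>

definition decay :: "real \<Rightarrow> real \<Rightarrow> real" where
  "decay \<alpha> \<rho> = (1 - \<alpha>) / (\<rho> - \<alpha>)"

lemma decay_pos: "\<alpha> < 1 \<Longrightarrow> 1 < \<rho> \<Longrightarrow> 0 < decay \<alpha> \<rho>"
  and decay_less_1: "\<alpha> < 1 \<Longrightarrow> 1 < \<rho> \<Longrightarrow> decay \<alpha> \<rho> < 1"
  by (simp_all add: decay_def)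

lemma decay_recursion:
  assumes "\<alpha> < \<rho>"
  shows "\<alpha> * decay \<alpha> \<rho> ^ Suc m + (1 - \<alpha>) * decay \<alpha> \<rho> ^ m = \<rho> * decay \<alpha> \<rho> ^ Suc m"
proof -
  have "\<alpha> * decay \<alpha> \<rho> + (1 - \<alpha>) = \<rho> * decay \<alpha> \<rho>" using assms by (simp add: decay_def field_simps)
  then have "(\<alpha> * decay \<alpha> \<rho> + (1 - \<alpha>)) * decay \<alpha> \<rho> ^ m = \<rho> * decay \<alpha> \<rho> * decay \<alpha> \<rho> ^ m" by simp
  then show ?thesis by (simp add: algebra_simps)
qed

text \<open>
  The ear has \<open>k\<close> inner vertices and starts in a part of size \<open>s\<close>; the other part has size
  \<open>r\<close>. The weights are \<open>b\<close> at the start of the ear, \<open>1\<close> on the rest of its part, \<open>y\<close> on the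
  other part, and powers of \<open>decay \<alpha> \<rho>\<close> along the ear.
\<close>

locale ear_subsolution =
  fixes \<alpha> \<rho> b y :: real and s r k :: nat
  assumes \<alpha>_bounds: "0 \<le> \<alpha>" "\<alpha> < 1" and \<rho>_gt_1: "1 < \<rho>" and b_ge: "1 \<le> b"
    and y_ge: "decay \<alpha> \<rho> \<le> y"
    and at_part: "\<rho> - \<alpha> * r \<le> (1 - \<alpha>) * (r * y)"
    and at_start: "(\<rho> - \<alpha> * r - \<alpha>) * b \<le> (1 - \<alpha>) * (r * y + decay \<alpha> \<rho> ^ k)"
    and at_opposite: "(\<rho> - \<alpha> * s) * y \<le> (1 - \<alpha>) * (real s - 1 + b)"

locale ear_solution =
  fixes \<alpha> \<rho> b y :: real and s r k :: nat
  assumes \<alpha>_bounds: "0 \<le> \<alpha>" "\<alpha> < 1" and \<rho>_gt_1: "1 < \<rho>" and b_gt: "1 < b"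
    and y_gt: "decay \<alpha> \<rho> < y"
    and at_part_eq: "\<rho> - \<alpha> * r = (1 - \<alpha>) * (r * y)"
    and at_start_eq: "(\<rho> - \<alpha> * r - \<alpha>) * b = (1 - \<alpha>) * (r * y + decay \<alpha> \<rho> ^ k)"
    and at_opposite_eq: "(\<rho> - \<alpha> * s) * y = (1 - \<alpha>) * (real s - 1 + b)"

sublocale ear_solution \<subseteq> ear_subsolution
  using \<alpha>_bounds \<rho>_gt_1 b_gt y_gt at_part_eq at_start_eq at_opposite_eq by unfold_locales auto

text \<open>Up to positive factors, this is what remains after eliminating \<open>b\<close> and \<open>y\<close>.\<close>

definition B1_char :: "real \<Rightarrow> real \<Rightarrow> real \<Rightarrow> nat \<Rightarrow> real \<Rightarrow> real" where
  "B1_char \<alpha> p q k \<rho> = (\<rho> - \<alpha> * p) * (\<rho> - \<alpha> * q) * (\<rho> - \<alpha> * q - \<alpha>)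
    - (1 - \<alpha>)\<^sup>2 * (p * q * (\<rho> - \<alpha> * q - \<alpha>) + q * (\<alpha> + (1 - \<alpha>) * decay \<alpha> \<rho> ^ k))"

lemma B1_char_neg:
  assumes \<alpha>_bounds: "0 \<le> \<alpha>" "\<alpha> < 1" and pq_ge_1: "1 \<le> p" "1 \<le> q"
    and l_eq: "l = max 1 (max (\<alpha> * p) (\<alpha> * (q + 1)))"
  shows "B1_char \<alpha> p q k l < 0"
proof -
  let ?R = "l - \<alpha> * q - \<alpha>"
  have bounds: "1 \<le> l" "\<alpha> * p \<le> l" "\<alpha> * (q + 1) \<le> l" by (auto simp: l_eq)
  have R_nonneg: "0 \<le> ?R" using bounds by (simp add: algebra_simps)
  have "(l - \<alpha> * p) * (l - \<alpha> * q) \<le> (1 - \<alpha>)\<^sup>2 * (p * q) \<or> ?R = 0"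
  proof -
    consider "l = 1" | "l = \<alpha> * p" | "l = \<alpha> * (q + 1)" unfolding l_eq by linarith
    then show ?thesis
    proof cases
      case 1
      have "\<alpha> * 1 \<le> \<alpha> * p" "\<alpha> * 1 \<le> \<alpha> * q" using \<alpha>_bounds pq_ge_1 by (intro mult_left_mono; simp)+
      then have "(l - \<alpha> * p) * (l - \<alpha> * q) \<le> (1 - \<alpha>) * (1 - \<alpha>)"
        using 1 bounds R_nonneg \<alpha>_bounds by (intro mult_mono) auto
      also have "\<dots> \<le> (1 - \<alpha>)\<^sup>2 * (p * q)"
        using pq_ge_1 mult_mono[of 1 p 1 q] mult_left_mono[of 1 "p * q" "(1 - \<alpha>)\<^sup>2"]
        by (simp add: power2_eq_square)
      finally show ?thesis ..
    qed (use pq_ge_1 in \<open>auto simp: algebra_simps\<close>)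
  qed
  then have "(l - \<alpha> * p) * (l - \<alpha> * q) * ?R \<le> (1 - \<alpha>)\<^sup>2 * (p * q) * ?R"
    using R_nonneg by (auto intro: mult_right_mono)
  moreover have "0 < (1 - \<alpha>)\<^sup>2 * (q * (\<alpha> + (1 - \<alpha>) * decay \<alpha> l ^ k))"
    using \<alpha>_bounds pq_ge_1 bounds(1) by (intro mult_pos_pos add_nonneg_pos) (auto simp: decay_def)
  ultimately show ?thesis by (simp add: B1_char_def algebra_simps)
qed

lemma B1_char_pos:
  assumes \<alpha>_bounds: "0 \<le> \<alpha>" "\<alpha> < 1" and pq_ge_1: "1 \<le> p" "1 \<le> q"
  shows "0 < B1_char \<alpha> p q k (p + q + 1)"
proof -
  define u where "u = p + q + 1"
  define R where "R = u - \<alpha> * q - \<alpha>"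
  define c where "c = \<alpha> + (1 - \<alpha>) * decay \<alpha> u ^ k"
  have alpha_mult_le: "\<alpha> * p \<le> p" "\<alpha> * q \<le> q"
    using \<alpha>_bounds pq_ge_1 by (auto intro: mult_left_le_one_le)
  then have R_ge_1: "1 \<le> R" using \<alpha>_bounds pq_ge_1 unfolding R_def u_def by linarith
  have u_gt_1: "1 < u" using pq_ge_1 by (simp add: u_def)
  have "decay \<alpha> u ^ k \<le> 1"
    using decay_pos[OF \<alpha>_bounds(2) u_gt_1] decay_less_1[OF \<alpha>_bounds(2) u_gt_1]
    by (intro power_le_one) auto
  then have c_bounds: "0 \<le> c" "c \<le> 1"
    using \<alpha>_bounds decay_pos[OF \<alpha>_bounds(2) u_gt_1] convex_bound_le[of 1 1 "decay \<alpha> u ^ k" \<alpha> "1 - \<alpha>"]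
    by (auto simp: c_def)
  have "(1 - \<alpha>)\<^sup>2 * (p * q * R + q * c) \<le> p * q * R + q * c"
    using \<alpha>_bounds R_ge_1 c_bounds pq_ge_1
    by (intro mult_left_le_one_le) (auto simp: power_le_one)
  also have "\<dots> \<le> p * q * R + q * R"
    using R_ge_1 c_bounds pq_ge_1 by (intro add_left_mono mult_left_mono) auto
  also have "\<dots> < (q + 1) * (p + 1) * R"
    using R_ge_1 pq_ge_1 by (simp add: algebra_simps add_strict_increasing)
  also have "\<dots> \<le> (u - \<alpha> * p) * (u - \<alpha> * q) * R"
    unfolding u_def
    by (intro mult_right_mono mult_mono; use R_ge_1 alpha_mult_le pq_ge_1 in linarith)
  finally show ?thesis by (simp add: B1_char_def R_def c_def u_def)
qed

lemma B1_char_root: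
  assumes \<alpha>_bounds: "0 \<le> \<alpha>" "\<alpha> < 1" and pq_ge_1: "1 \<le> p" "1 \<le> q"
  obtains \<rho> where "1 < \<rho>" "\<alpha> * p < \<rho>" "\<alpha> * (q + 1) < \<rho>" "B1_char \<alpha> p q k \<rho> = 0"
proof -
  define l where "l = max 1 (max (\<alpha> * p) (\<alpha> * (q + 1)))"
  have neg: "B1_char \<alpha> p q k l < 0" by (rule B1_char_neg[OF assms l_def])
  have pos: "0 < B1_char \<alpha> p q k (p + q + 1)" by (rule B1_char_pos[OF assms])
  have "\<alpha> * p \<le> p" "\<alpha> * (q + 1) \<le> q + 1"
    using \<alpha>_bounds pq_ge_1 by (auto intro: mult_left_le_one_le)
  then have "l \<le> p + q + 1" unfolding l_def using pq_ge_1 by linarith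
  moreover have "continuous_on {l..p + q + 1} (B1_char \<alpha> p q k)"
    unfolding B1_char_def decay_def using \<alpha>_bounds by (intro continuous_intros) (auto simp: l_def)
  ultimately obtain \<rho> where \<rho>_root: "l \<le> \<rho>" "B1_char \<alpha> p q k \<rho> = 0"
    using IVT'[of "B1_char \<alpha> p q k" l 0 "p + q + 1"] neg pos by auto
  with neg have "l < \<rho>" by (cases "l = \<rho>") auto
  then show ?thesis using \<rho>_root(2) by (intro that[of \<rho>]) (auto simp: l_def)
qed

lemma ear_solution_of_root:
  fixes \<alpha> \<rho> :: real and s r k :: nat
  assumes \<alpha>_bounds: "0 \<le> \<alpha>" "\<alpha> < 1" and sr_ge_1: "1 \<le> s" "1 \<le> r"
    and \<rho>_gt: "1 < \<rho>" "\<alpha> * s < \<rho>" "\<alpha> * (real r + 1) < \<rho>" and root: "B1_char \<alpha> s r k \<rho> = 0"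
  defines "R \<equiv> \<rho> - \<alpha> * r - \<alpha>" and "c \<equiv> \<alpha> + (1 - \<alpha>) * decay \<alpha> \<rho> ^ k"
  shows "ear_solution \<alpha> \<rho> (1 + c / R) ((\<rho> - \<alpha> * r) / ((1 - \<alpha>) * r)) s r k"
proof
  let ?y = "(\<rho> - \<alpha> * r) / ((1 - \<alpha>) * r)"
  have R_pos: "0 < R" using \<rho>_gt by (simp add: R_def algebra_simps)
  have c_pos: "0 < c" unfolding c_def
    using \<alpha>_bounds decay_pos[OF \<alpha>_bounds(2) \<rho>_gt(1)] by (intro add_nonneg_pos) auto
  show b_gt_1: "1 < 1 + c / R" using c_pos R_pos by simp
  show part: "\<rho> - \<alpha> * r = (1 - \<alpha>) * (r * ?y)" using \<alpha>_bounds sr_ge_1 by simp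
  show "(\<rho> - \<alpha> * r - \<alpha>) * (1 + c / R) = (1 - \<alpha>) * (r * ?y + decay \<alpha> \<rho> ^ k)"
    unfolding distrib_left[of "1 - \<alpha>"] part[symmetric] R_def[symmetric] using R_pos
    by (simp add: distrib_left) (simp add: R_def c_def)
  have "(\<rho> - \<alpha> * s) * (\<rho> - \<alpha> * r) * R = (1 - \<alpha>)\<^sup>2 * (s * r * R + r * c)"
    using root by (simp add: B1_char_def R_def c_def)
  then have "(\<rho> - \<alpha> * s) * (\<rho> - \<alpha> * r) = (1 - \<alpha>)\<^sup>2 * r * (s + c / R)"
    using R_pos by (simp add: field_simps)
  then show opposite: "(\<rho> - \<alpha> * s) * ?y = (1 - \<alpha>) * (real s - 1 + (1 + c / R))"
    using \<alpha>_bounds sr_ge_1 by (simp add: power2_eq_square divide_eq_eq mult.assoc)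
  have "0 < ?y" using R_pos \<alpha>_bounds sr_ge_1 by (simp add: R_def)
  have "(1 - \<alpha>) * 1 < (1 - \<alpha>) * (real s - 1 + (1 + c / R))"
    using \<alpha>_bounds b_gt_1 sr_ge_1 by (intro mult_strict_left_mono) auto
  also have "\<dots> \<le> (\<rho> - \<alpha>) * ?y"
    unfolding opposite[symmetric] using \<open>0 < ?y\<close> \<alpha>_bounds sr_ge_1 mult_left_mono[of 1 "real s" \<alpha>]
    by (intro mult_right_mono) auto
  finally show "decay \<alpha> \<rho> < ?y"
    using \<alpha>_bounds \<rho>_gt by (simp add: decay_def divide_less_eq mult.commute)
qed (use \<alpha>_bounds \<rho>_gt in auto)

lemma ear_solution_exists:
  fixes \<alpha> :: real and s r k :: nat
  assumes "0 \<le> \<alpha>" "\<alpha> < 1" "1 \<le> s" "1 \<le> r"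
  obtains \<rho> b y where "ear_solution \<alpha> \<rho> b y s r k"
proof -
  have "1 \<le> real s" "1 \<le> real r" using assms by auto
  from B1_char_root[OF assms(1,2) this] show ?thesis
    using ear_solution_of_root[OF assms] that by metis
qed

context ear_solution
begin

lemma decay_gt_0: "0 < decay \<alpha> \<rho>"
  by (rule decay_pos[OF \<alpha>_bounds(2) \<rho>_gt_1])

lemma opposite_factor_pos: "0 < \<rho> - \<alpha> * s"
proof -
  have "0 < (\<rho> - \<alpha> * s) * y" unfolding at_opposite_eq
    using \<alpha>_bounds b_gt by (intro mult_pos_pos) auto
  then show ?thesis using decay_gt_0 y_gt by (simp add: zero_less_mult_iff)
qed

lemma factor_product: "(\<rho> - \<alpha> * s) * (\<rho> - \<alpha> * r) = (1 - \<alpha>)\<^sup>2 * r * (real s - 1 + b)"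
proof -
  have "(\<rho> - \<alpha> * s) * (\<rho> - \<alpha> * r) = (1 - \<alpha>) * r * ((\<rho> - \<alpha> * s) * y)" by (simp add: at_part_eq)
  also have "\<dots> = (1 - \<alpha>)\<^sup>2 * r * (real s - 1 + b)" by (simp add: at_opposite_eq power2_eq_square)
  finally show ?thesis .
qed

lemma excess_at_start: "(\<rho> - \<alpha> * r - \<alpha>) * (b - 1) = \<alpha> + (1 - \<alpha>) * decay \<alpha> \<rho> ^ k"
proof -
  have "(\<rho> - \<alpha> * r - \<alpha>) * (b - 1) = (\<rho> - \<alpha> * r - \<alpha>) * b - (\<rho> - \<alpha> * r) + \<alpha>"
    by (simp add: algebra_simps)
  then show ?thesis using at_start_eq at_part_eq by (simp add: distrib_left)
qed

lemma swapped_start_slack: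
  assumes r_bounds: "1 \<le> r" "r < s"
  shows "(\<rho> - \<alpha> * s - \<alpha>) * (1 + r / s * (b - 1)) < \<rho> - \<alpha> * s + (1 - \<alpha>) * decay \<alpha> \<rho> ^ k"
proof -
  have pos: "0 < (\<rho> - \<alpha> * r - \<alpha>) * (b - 1)"
    unfolding excess_at_start using \<alpha>_bounds decay_gt_0 by (intro add_nonneg_pos) auto
  have "(\<rho> - \<alpha> * s - \<alpha>) * (r / s * (b - 1)) = r / s * ((\<rho> - \<alpha> * s - \<alpha>) * (b - 1))" by simp
  also have "\<dots> \<le> r / s * ((\<rho> - \<alpha> * r - \<alpha>) * (b - 1))"
    using b_gt \<alpha>_bounds r_bounds
    by (intro mult_left_mono mult_right_mono) (auto simp: mult_left_mono)
  also have "\<dots> < 1 * ((\<rho> - \<alpha> * r - \<alpha>) * (b - 1))"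
    using pos r_bounds by (intro mult_strict_right_mono) auto
  finally show ?thesis using excess_at_start by (simp add: algebra_simps)
qed

lemma decay_le_swapped_opposite:
  assumes r_bounds: "1 \<le> r" "r < s"
  shows "decay \<alpha> \<rho> \<le> (\<rho> - \<alpha> * s) / ((1 - \<alpha>) * s)"
proof -
  have "(1 - \<alpha>)\<^sup>2 * (1 * real s) \<le> (1 - \<alpha>)\<^sup>2 * (r * (real s - 1 + b))"
    using r_bounds b_gt by (intro mult_left_mono mult_mono) auto
  also have "\<dots> = (\<rho> - \<alpha> * s) * (\<rho> - \<alpha> * r)" by (simp add: factor_product)
  also have "\<dots> \<le> (\<rho> - \<alpha> * s) * (\<rho> - \<alpha>)"
    using opposite_factor_pos r_bounds \<alpha>_bounds mult_left_mono[of 1 "real r" \<alpha>]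
    by (intro mult_left_mono) auto
  finally show ?thesis
    using \<alpha>_bounds \<rho>_gt_1 r_bounds by (simp add: decay_def power2_eq_square field_simps)
qed

text \<open>
  For an ear starting in the smaller part, two of the three conditions are solved with equality; the
  one at the start of the ear then has slack.
\<close>

lemma swapped_ear_subsolution:
  assumes r_bounds: "1 \<le> r" "r < s"
  obtains b' y' :: real where "ear_subsolution \<alpha> \<rho> b' y' r s k"
    and "(\<rho> - \<alpha> * s - \<alpha>) * b' < (1 - \<alpha>) * (s * y' + decay \<alpha> \<rho> ^ k)"
proof -
  define b' where "b' = 1 + r / s * (b - 1)"
  define y' where "y' = (\<rho> - \<alpha> * s) / ((1 - \<alpha>) * s)"
  have part: "\<rho> - \<alpha> * s = (1 - \<alpha>) * (s * y')" using \<alpha>_bounds r_bounds by (simp add: y'_def)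
  have start: "(\<rho> - \<alpha> * s - \<alpha>) * b' < (1 - \<alpha>) * (s * y' + decay \<alpha> \<rho> ^ k)"
    using swapped_start_slack[OF r_bounds]
    unfolding distrib_left[of "1 - \<alpha>"] part[symmetric] b'_def .
  have "(\<rho> - \<alpha> * r) * y' = (\<rho> - \<alpha> * s) * (\<rho> - \<alpha> * r) / ((1 - \<alpha>) * s)" by (simp add: y'_def)
  also have "\<dots> = (1 - \<alpha>) * (real r - 1 + b')"
    unfolding factor_product using \<alpha>_bounds r_bounds
    by (simp add: b'_def field_simps power2_eq_square)
  finally have opposite: "(\<rho> - \<alpha> * r) * y' = (1 - \<alpha>) * (real r - 1 + b')" .
  have "1 \<le> b'" using b_gt by (simp add: b'_def)
  moreover have "decay \<alpha> \<rho> \<le> y'" unfolding y'_def by (rule decay_le_swapped_opposite[OF r_bounds])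
  ultimately have "ear_subsolution \<alpha> \<rho> b' y' r s k"
    using \<alpha>_bounds \<rho>_gt_1 part start opposite by unfold_locales auto
  then show ?thesis using that start by blast
qed

end

definition biclique_weight ::
    "'a set \<Rightarrow> 'a set \<Rightarrow> 'a \<Rightarrow> ('a \<Rightarrow> nat) \<Rightarrow> real \<Rightarrow> real \<Rightarrow> real \<Rightarrow> 'a \<Rightarrow> real" where
  "biclique_weight S T v d t b y u =
    (if u = v then b else if u \<in> S then 1 else if u \<in> T then y else t ^ d u)"

lemma biclique_weight_pos: "0 < t \<Longrightarrow> 0 < b \<Longrightarrow> 0 < y \<Longrightarrow> 0 < biclique_weight S T v d t b y u"
  by (simp add: biclique_weight_def)

context
  fixes S T :: "'a set" and v :: 'a and d :: "'a \<Rightarrow> nat" and \<alpha> t b y :: real and z :: "'a \<Rightarrow> real"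
  assumes fin: "finite S" "finite T" and disjoint: "S \<inter> T = {}" and v: "v \<in> S"
  defines "z \<equiv> biclique_weight S T v d t b y"
begin

lemma sum_biclique_weight: "sum z S = real (card S) - 1 + b" "sum z T = card T * y"
proof -
  have "sum z S = b + sum z (S - {v})"
    using fin(1) v by (subst sum.remove[of S v]) (auto simp: z_def biclique_weight_def)
  also have "sum z (S - {v}) = (\<Sum>u\<in>S - {v}. 1)"
    by (rule sum.cong) (auto simp: z_def biclique_weight_def)
  also have "\<dots> = real (card S) - 1"
  proof -
    have "0 < card S" using fin(1) v by (auto simp: card_gt_0_iff)
    then show ?thesis using fin(1) v by (simp add: of_nat_diff)
  qed
  finally show "sum z S = real (card S) - 1 + b" by simp
  have "sum z T = (\<Sum>u\<in>T. y)"
    using disjoint v by (intro sum.cong) (auto simp: z_def biclique_weight_def)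
  then show "sum z T = card T * y" by simp
qed

lemma alpha_sum_at_start:
  assumes "w \<notin> S \<union> T"
  shows "alpha_sum \<alpha> z v (insert w T)
    = (\<alpha> * card T + \<alpha>) * b + (1 - \<alpha>) * (card T * y + t ^ d w)"
proof -
  have "z v = b" "z w = t ^ d w" using assms v by (auto simp: z_def biclique_weight_def)
  then show ?thesis using assms fin by (simp add: alpha_sum_eq sum_biclique_weight algebra_simps)
qed

lemma alpha_sum_at_part:
  assumes "u \<in> S" "u \<noteq> v"
  shows "alpha_sum \<alpha> z u T = \<alpha> * card T + (1 - \<alpha>) * (card T * y)"
proof -
  have "z u = 1" using assms by (simp add: z_def biclique_weight_def)
  then show ?thesis by (simp add: alpha_sum_eq sum_biclique_weight)
qed

lemma alpha_sum_at_opposite: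
  assumes "u \<in> T"
  shows "alpha_sum \<alpha> z u S = \<alpha> * card S * y + (1 - \<alpha>) * (real (card S) - 1 + b)"
proof -
  have "z u = y" using assms disjoint v by (auto simp: z_def biclique_weight_def)
  then show ?thesis by (simp add: alpha_sum_eq sum_biclique_weight)
qed

end

section \<open>The extremal digraph\<close>

lemma vwalk_arcs_eq_zip: "vwalk_arcs p = zip p (tl p)"
  by (induction p rule: vwalk_arcs.induct) auto

lemma set_vwalk_arcs_upt: "set (vwalk_arcs [a..<b]) = {(i, Suc i) | i. a \<le> i \<and> Suc i < b}"
proof -
  have "vwalk_arcs [a..<b] = map (\<lambda>i. (i, Suc i)) [a..<b - 1]"
    unfolding vwalk_arcs_eq_zip by (rule nth_equalityI) auto
  then show ?thesis by auto
qed

lemma arcs_ends_B1: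
  assumes "p + q < n"
  shows "arcs_ends (with_proj (B1 n p q)) = {1..p} \<times> {p+1..p+q} \<union> {p+1..p+q} \<times> {1..p}
    \<union> {(1, p+q+1), (n, p)} \<union> {(i, Suc i) | i. p + q < i \<and> i < n}"
proof -
  have "set (vwalk_arcs (1 # [p+q+1..<n+1] @ [p]))
      = {(1, p+q+1), (n, p)} \<union> set (vwalk_arcs [p+q+1..<n+1])"
    using assms by (simp add: set_vwalk_arcs_snoc upt_conv_Cons[of "Suc (p+q)" n]
        del: upt_Suc vwalk_arcs.simps)
  also have "set (vwalk_arcs [p+q+1..<n+1]) = {(i, Suc i) | i. p + q < i \<and> i < n}"
    unfolding set_vwalk_arcs_upt by auto
  finally show ?thesis
    by (simp only: B1_def K_bip_def pair_pre_digraph.simps with_proj_simps Un_assoc)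
qed

lemma out_neighbours_B1:
  assumes "p + q < n" "2 \<le> p" "1 \<le> q"
  defines "N \<equiv> out_neighbours (with_proj (B1 n p q))"
  shows "N 1 = insert (p+q+1) {p+1..p+q}"
    and "\<lbrakk>1 < i; i \<le> p\<rbrakk> \<Longrightarrow> N i = {p+1..p+q}"
    and "\<lbrakk>p < i; i \<le> p + q\<rbrakk> \<Longrightarrow> N i = {1..p}"
    and "\<lbrakk>p + q < i; i < n\<rbrakk> \<Longrightarrow> N i = {Suc i}"
    and "N n = {p}"
  using assms(1-3) unfolding N_def arcs_ends_B1[OF assms(1)] by auto

lemma verts_B1: "p + q \<le> n \<Longrightarrow> verts (with_proj (B1 n p q)) = {1..n}"
  by (auto simp: B1_def K_bip_def)

lemma digraph_B1:
  assumes "p + q < n" "2 \<le> p" "1 \<le> q"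
  shows "digraph (with_proj (B1 n p q))"
proof -
  have arcs: "parcs (B1 n p q) = {1..p} \<times> {p+1..p+q} \<union> {p+1..p+q} \<times> {1..p}
    \<union> {(1, p+q+1), (n, p)} \<union> {(i, Suc i) | i. p + q < i \<and> i < n}"
    using arcs_ends_B1[OF assms(1)] by simp
  have verts: "pverts (B1 n p q) = {1..n}" using verts_B1 assms(1) by simp
  have sub: "parcs (B1 n p q) \<subseteq> {1..n} \<times> {1..n}" unfolding arcs using assms by auto
  have "finite (parcs (B1 n p q))" by (rule finite_subset[OF sub]) simp
  then have "pair_digraph (B1 n p q)"
    using sub assms(1) by unfold_locales (auto simp: verts, auto simp: arcs)
  then interpret pair_digraph "B1 n p q" .
  show ?thesis by (rule digraph_axioms)
qed

context ear_solution
begin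

definition B1_weight :: "nat \<Rightarrow> real" where
  "B1_weight = biclique_weight {1..s} {s+1..s+r} 1 (\<lambda>i. s + r + k + 1 - i) (decay \<alpha> \<rho>) b y"

lemma B1_weight_simps:
  "B1_weight 1 = b"
  "1 < i \<Longrightarrow> i \<le> s \<Longrightarrow> B1_weight i = 1"
  "1 \<le> s \<Longrightarrow> s < i \<Longrightarrow> i \<le> s + r \<Longrightarrow> B1_weight i = y"
  "1 \<le> s \<Longrightarrow> s + r < i \<Longrightarrow> B1_weight i = decay \<alpha> \<rho> ^ (s + r + k + 1 - i)"
  by (auto simp: B1_weight_def biclique_weight_def)

lemma alpha_sum_B1_weight:
  assumes s: "1 \<le> s"
  shows "alpha_sum \<alpha> B1_weight 1 (insert (s+r+1) {s+1..s+r}) = \<rho> * b"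
    and "1 < i \<Longrightarrow> i \<le> s \<Longrightarrow> alpha_sum \<alpha> B1_weight i {s+1..s+r} = \<rho>"
    and "s < i \<Longrightarrow> i \<le> s + r \<Longrightarrow> alpha_sum \<alpha> B1_weight i {1..s} = \<rho> * y"
proof -
  let ?S = "{1..s}" and ?T = "{s+1..s+r}"
  have parts: "finite ?S" "finite ?T" "?S \<inter> ?T = {}" "1 \<in> ?S" using s by auto
  have "alpha_sum \<alpha> B1_weight 1 (insert (s+r+1) ?T)
      = (\<alpha> * card ?T + \<alpha>) * b + (1 - \<alpha>) * (card ?T * y + decay \<alpha> \<rho> ^ (s + r + k + 1 - (s+r+1)))"
    unfolding B1_weight_def by (rule alpha_sum_at_start[OF parts]) auto
  then show "alpha_sum \<alpha> B1_weight 1 (insert (s+r+1) ?T) = \<rho> * b"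
    using at_start_eq by (simp add: algebra_simps)
  show "alpha_sum \<alpha> B1_weight i ?T = \<rho>" if i: "1 < i" "i \<le> s"
    unfolding B1_weight_def
    by (subst alpha_sum_at_part[OF parts]) (use i at_part_eq in \<open>auto simp: algebra_simps\<close>)
  show "alpha_sum \<alpha> B1_weight i ?S = \<rho> * y" if i: "s < i" "i \<le> s + r"
    unfolding B1_weight_def
    by (subst alpha_sum_at_opposite[OF parts]) (use i at_opposite_eq in \<open>auto simp: algebra_simps\<close>)
qed

lemma A_alpha_op_B1_weight:
  assumes s_ge_2: "2 \<le> s" and r_ge_1: "1 \<le> r" and k_pos: "0 < k"
    and i_bounds: "1 \<le> i" "i \<le> s + r + k"
  shows "A_alpha_op \<alpha> (with_proj (B1 (s + r + k) s r)) B1_weight i = \<rho> * B1_weight i"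
proof -
  have s_ge_1: "1 \<le> s" using s_ge_2 by simp
  have "s + r < s + r + k" using k_pos by simp
  note N = out_neighbours_B1[OF this s_ge_2 r_ge_1]
  consider (start) "i = 1" | (part) "1 < i" "i \<le> s" | (opposite) "s < i" "i \<le> s + r"
    | (ear) "s + r < i" "i < s + r + k" | (last) "i = s + r + k"
    using i_bounds by linarith
  then show ?thesis
  proof cases
    case start
    show ?thesis
      unfolding A_alpha_op_def start N(1) B1_weight_simps(1) by (rule alpha_sum_B1_weight[OF s_ge_1])
  next
    case part
    show ?thesis
      unfolding A_alpha_op_def N(2)[OF part] alpha_sum_B1_weight(2)[OF s_ge_1 part]
      by (simp add: B1_weight_simps(2)[OF part])
  next
    case opposite
    show ?thesis
      unfolding A_alpha_op_def N(3)[OF opposite] alpha_sum_B1_weight(3)[OF s_ge_1 opposite]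
      by (simp add: B1_weight_simps(3)[OF s_ge_1 opposite])
  next
    case ear
    then have "s + r + k + 1 - i = Suc (s + r + k - i)" by simp
    then show ?thesis
      using ear decay_recursion[of \<alpha> \<rho> "s + r + k - i"] \<alpha>_bounds \<rho>_gt_1
      unfolding A_alpha_op_def N(4)[OF ear]
      by (simp add: alpha_sum_singleton B1_weight_simps(4)[OF s_ge_1])
  next
    case last
    have "B1_weight s = 1" using s_ge_2 by (intro B1_weight_simps(2)) auto
    then show ?thesis
      using k_pos decay_recursion[of \<alpha> \<rho> 0] \<alpha>_bounds \<rho>_gt_1 unfolding A_alpha_op_def last N(5)
      by (simp add: alpha_sum_singleton B1_weight_simps(4)[OF s_ge_1])
  qed
qed

lemma lambda_alpha_B1:
  assumes s_ge_2: "2 \<le> s" and r_ge_1: "1 \<le> r" and k_pos: "0 < k"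
  shows "lambda_alpha \<alpha> (with_proj (B1 (s + r + k) s r)) = \<rho>"
proof -
  have n_gt: "s + r < s + r + k" using k_pos by simp
  show ?thesis
  proof (rule digraph.lambda_alpha_eqI[OF digraph_B1[OF n_gt s_ge_2 r_ge_1] \<alpha>_bounds],
      unfold verts_B1[OF less_imp_le[OF n_gt]])
    show "{1..s + r + k} \<noteq> {}" using k_pos by simp
    show "0 < B1_weight i" for i
      unfolding B1_weight_def using b_gt y_gt decay_gt_0 by (intro biclique_weight_pos) auto
    show "A_alpha_op \<alpha> (with_proj (B1 (s + r + k) s r)) B1_weight i = \<rho> * B1_weight i"
      if "i \<in> {1..s + r + k}" for i
      using that by (intro A_alpha_op_B1_weight[OF s_ge_2 r_ge_1 k_pos]) auto
  qed
qed

end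

section \<open>Distance to a set of vertices\<close>

definition dist_to :: "('a,'b) pre_digraph \<Rightarrow> 'a set \<Rightarrow> 'a \<Rightarrow> nat" where
  "dist_to G S u = (LEAST m. \<exists>s\<in>S. (u, s) \<in> arcs_ends G ^^ m)"

lemma dist_to_le: "s \<in> S \<Longrightarrow> (u, s) \<in> arcs_ends G ^^ m \<Longrightarrow> dist_to G S u \<le> m"
  unfolding dist_to_def by (rule Least_le) blast

context wf_digraph
begin

lemma bipartite_closed_walk_even:
  assumes "bipartite_digraph G" and "(u, u) \<in> arcs_ends G ^^ m"
  shows "even m"
proof -
  obtain X Y where XY: "X \<inter> Y = {}"
    "\<And>u v. u \<rightarrow> v \<Longrightarrow> u \<in> X \<and> v \<in> Y \<or> u \<in> Y \<and> v \<in> X"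
    using assms(1) unfolding bipartite_digraph_def by blast
  have "even m \<longleftrightarrow> (u \<in> X \<longleftrightarrow> u' \<in> X)" if "(u, u') \<in> arcs_ends G ^^ m" for u' m
    using that
  proof (induction m arbitrary: u')
    case (Suc m)
    then obtain x where x: "(u, x) \<in> arcs_ends G ^^ m" "x \<rightarrow> u'" by auto
    then show ?case using Suc.IH[OF x(1)] XY(1) XY(2)[OF x(2)] by auto
  qed simp
  then show ?thesis using assms(2) by blast
qed

context
  fixes S :: "'a set"
  assumes strong: "strongly_connected G" and S: "S \<subseteq> verts G" "S \<noteq> {}"
begin

lemma dist_to_attained:
  assumes "u \<in> verts G"
  shows "\<exists>s\<in>S. (u, s) \<in> arcs_ends G ^^ dist_to G S u"
proof -
  obtain s where s: "s \<in> S" using S(2) by blast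
  then have "u \<rightarrow>\<^sup>* s" using strong assms S(1) by (auto simp: strongly_connected_def)
  from rtrancl_imp_relpow[OF reachable_rtranclI[OF this]]
  obtain m where "(u, s) \<in> arcs_ends G ^^ m" by blast
  then have "\<exists>m. \<exists>s\<in>S. (u, s) \<in> arcs_ends G ^^ m" using s by blast
  then show ?thesis unfolding dist_to_def by (rule LeastI_ex)
qed

lemma dist_to_eq_0_iff:
  assumes "u \<in> verts G"
  shows "dist_to G S u = 0 \<longleftrightarrow> u \<in> S"
proof
  assume "dist_to G S u = 0"
  then show "u \<in> S" using dist_to_attained[OF assms] by auto
next
  assume "u \<in> S"
  then show "dist_to G S u = 0" using dist_to_le[of u S u 0 G] by simp
qed

lemma dist_to_SucE:
  assumes u: "u \<in> verts G" "dist_to G S u = Suc m"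
  obtains u' where "u' \<in> verts G" "u \<rightarrow> u'" "dist_to G S u' = m"
proof -
  obtain s where s: "s \<in> S" "(u, s) \<in> arcs_ends G ^^ Suc m"
    using dist_to_attained[OF u(1)] unfolding u(2) by blast
  then obtain u' where u': "u \<rightarrow> u'" "(u', s) \<in> arcs_ends G ^^ m" using relpow_Suc_D2 by metis
  then have verts: "u' \<in> verts G" using adj_in_verts by blast
  obtain s' where s': "s' \<in> S" "(u', s') \<in> arcs_ends G ^^ dist_to G S u'"
    using dist_to_attained[OF verts] by blast
  have "Suc m \<le> Suc (dist_to G S u')"
    using dist_to_le[OF s'(1) relpow_Suc_I2[OF u'(1) s'(2)]] u(2) by simp
  moreover have "dist_to G S u' \<le> m" by (rule dist_to_le[OF s(1) u'(2)])
  ultimately show ?thesis using that verts u'(1) by simp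
qed

lemma atMost_dist_to_subset:
  assumes "u \<in> verts G"
  shows "{..dist_to G S u} \<subseteq> dist_to G S ` verts G"
proof
  fix j assume "j \<in> {..dist_to G S u}"
  then have "j \<le> dist_to G S u" by simp
  then show "j \<in> dist_to G S ` verts G"
  proof (induction rule: inc_induct)
    case base
    show ?case using assms by blast
  next
    case (step m)
    then obtain u' where u': "u' \<in> verts G" "dist_to G S u' = Suc m" by auto
    from dist_to_SucE[OF u'] show ?case by blast
  qed
qed

end

end

section \<open>Digraphs with an arc leaving a biclique\<close>

locale biclique_exit = digraph G for G :: "('a,'b) pre_digraph" (structure) +
  fixes S T :: "'a set" and v w :: 'a
  assumes strong: "strongly_connected G" and bipartite: "bipartite_digraph G"
    and biclique: "S \<times> T \<union> T \<times> S \<subseteq> arcs_ends G" and T_nonempty: "T \<noteq> {}"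
    and odd_rest: "odd (card (verts G - (S \<union> T)))"
    and exit: "v \<in> S" "w \<notin> S \<union> T" "v \<rightarrow>\<^bsub>G\<^esub> w"
begin

abbreviation rest :: "'a set" where "rest \<equiv> verts G - (S \<union> T)"

abbreviation depth :: "'a \<Rightarrow> nat" where "depth \<equiv> dist_to G S"

lemma S_verts: "S \<subseteq> verts G" and T_verts: "T \<subseteq> verts G"
  using biclique T_nonempty exit(1) adj_in_verts by blast+

lemma finite_S [simp]: "finite S" and finite_T [simp]: "finite T"
  using finite_subset[OF S_verts] finite_subset[OF T_verts] by simp_all

lemma disjoint: "S \<inter> T = {}"
  using biclique adj_not_same by blast

lemma S_nonempty: "S \<noteq> {}"
  using exit(1) by blast

lemma card_rest_pos: "0 < card rest"
  using odd_rest by (rule odd_pos)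

lemma w_rest: "w \<in> rest"
  using exit adj_in_verts by blast

lemma card_verts: "card (verts G) = card S + card T + card rest"
  using card_Un_disjoint[OF finite_S finite_T disjoint] S_verts T_verts
    card_Diff_subset[of "S \<union> T" "verts G"] card_mono[of "verts G" "S \<union> T"] by simp

lemma card_parts_less: "card S + card T < card (verts G)"
  using card_rest_pos by (simp add: card_verts)

lemma card_T_pos: "1 \<le> card T"
  using T_nonempty by (simp add: Suc_le_eq card_gt_0_iff)

lemmas depth_attained = dist_to_attained[OF strong S_verts S_nonempty]
  and depth_eq_0_iff = dist_to_eq_0_iff[OF strong S_verts S_nonempty]
  and depth_SucE = dist_to_SucE[OF strong S_verts S_nonempty]
  and atMost_depth_subset = atMost_dist_to_subset[OF strong S_verts S_nonempty]

lemma depth_T: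
  assumes "u \<in> T"
  shows "depth u = 1"
proof -
  have "(u, v) \<in> arcs_ends G ^^ 1" using assms exit(1) biclique by auto
  then have "depth u \<le> 1" by (rule dist_to_le[OF exit(1)])
  moreover have "depth u \<noteq> 0" using depth_eq_0_iff assms T_verts disjoint by auto
  ultimately show ?thesis by simp
qed

lemma depth_restE:
  assumes "u \<in> rest"
  obtains u' where "u' \<in> verts G" "u \<rightarrow> u'" "depth u = Suc (depth u')"
proof -
  obtain m where "depth u = Suc m" using depth_eq_0_iff[of u] assms by (cases "depth u") auto
  then show ?thesis using depth_SucE[of u m] assms that by blast
qed

lemma odd_depth_w: "odd (depth w)"
proof -
  have "w \<in> verts G" using w_rest by blast
  then obtain s where s: "s \<in> S" "(w, s) \<in> arcs_ends G ^^ depth w"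
    using depth_attained by blast
  obtain x where "x \<in> T" using T_nonempty by blast
  then have x: "s \<rightarrow> x" "x \<rightarrow> v" using biclique s(1) exit(1) by auto
  have "(v, v) \<in> arcs_ends G ^^ Suc (Suc (Suc (depth w)))"
    by (rule relpow_Suc_I[OF relpow_Suc_I[OF relpow_Suc_I2[OF exit(3) s(2)] x(1)] x(2)])
  from bipartite_closed_walk_even[OF bipartite this] show ?thesis by simp
qed

text \<open>
  Levels \<open>2, \<dots>, depth w\<close> lie outside the biclique, so \<open>depth w \<le> card rest + 1\<close>; parity excludes
  equality.
\<close>

lemma depth_w_le: "depth w \<le> card rest"
proof -
  have "{2..depth w} \<subseteq> depth ` rest"
  proof
    fix j assume j: "j \<in> {2..depth w}"
    then have "j \<in> depth ` verts G"
      using w_rest by (intro subsetD[OF atMost_depth_subset[of w]]) auto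
    then obtain u where u: "u \<in> verts G" "depth u = j" by blast
    then have "u \<notin> S" "u \<notin> T" using j depth_eq_0_iff[of u] depth_T[of u] by auto
    then show "j \<in> depth ` rest" using u by auto
  qed
  then have "card {2..depth w} \<le> card rest" by (intro surj_card_le) auto
  then have "depth w \<le> Suc (card rest)" by simp
  then show ?thesis using odd_depth_w odd_rest by (cases "depth w = Suc (card rest)") auto
qed

end

locale weighted_biclique_exit =
  biclique_exit G S T v w + ear_subsolution \<alpha> \<rho> b y "card S" "card T" "card (verts G - (S \<union> T))"
  for G :: "('a,'b) pre_digraph" (structure) and S T v w \<alpha> \<rho> b y
begin

abbreviation t :: real where "t \<equiv> decay \<alpha> \<rho>"

abbreviation z :: "'a \<Rightarrow> real" where "z \<equiv> biclique_weight S T v depth t b y"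

lemma t_pos: "0 < t" and t_less_1: "t < 1"
  using decay_pos decay_less_1 \<alpha>_bounds \<rho>_gt_1 by auto

lemma z_pos: "0 < z u"
  using t_pos b_ge y_ge by (intro biclique_weight_pos) auto

lemma z_v: "z v = b"
  by (simp add: biclique_weight_def)

lemma z_S: "u \<in> S \<Longrightarrow> u \<noteq> v \<Longrightarrow> z u = 1"
  by (simp add: biclique_weight_def)

lemma z_T: "u \<in> T \<Longrightarrow> z u = y"
  using disjoint exit(1) by (auto simp: biclique_weight_def)

lemma z_rest: "u \<in> rest \<Longrightarrow> z u = t ^ depth u"
  using exit(1) by (auto simp: biclique_weight_def)

lemma power_depth_le_z: "u \<in> verts G \<Longrightarrow> t ^ depth u \<le> z u"
  using b_ge y_ge depth_eq_0_iff[of u] depth_T[of u] exit(1) by (auto simp: biclique_weight_def)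

lemmas alpha_sum_z_start = alpha_sum_at_start[OF finite_S finite_T disjoint exit(1,2)]
  and alpha_sum_z_part = alpha_sum_at_part[OF finite_S finite_T disjoint exit(1)]
  and alpha_sum_z_opposite = alpha_sum_at_opposite[OF finite_S finite_T disjoint exit(1)]

lemma power_card_rest_le: "(1 - \<alpha>) * t ^ card rest \<le> (1 - \<alpha>) * t ^ depth w"
  using depth_w_le t_pos t_less_1 \<alpha>_bounds by (intro mult_left_mono power_decreasing) auto

lemma start_neighbours: "insert w T \<subseteq> out_neighbours G v"
  and part_neighbours: "u \<in> S \<Longrightarrow> T \<subseteq> out_neighbours G u"
  and opposite_neighbours: "u \<in> T \<Longrightarrow> S \<subseteq> out_neighbours G u"
  using exit biclique by auto

lemma z_le_at_start: "\<rho> * z v \<le> alpha_sum \<alpha> z v (insert w T)"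
  unfolding alpha_sum_z_start z_v using at_start power_card_rest_le by (simp add: algebra_simps)

lemma z_le_at_part: "u \<in> S \<Longrightarrow> u \<noteq> v \<Longrightarrow> \<rho> * z u \<le> alpha_sum \<alpha> z u T"
  using at_part by (simp add: alpha_sum_z_part z_S)

lemma z_le_at_opposite: "u \<in> T \<Longrightarrow> \<rho> * z u \<le> alpha_sum \<alpha> z u S"
  using at_opposite by (simp add: alpha_sum_z_opposite z_T algebra_simps)

lemma z_rest_recursion:
  assumes "u \<in> rest" "depth u = Suc m"
  shows "\<rho> * z u = \<alpha> * z u + (1 - \<alpha>) * t ^ m"
  using decay_recursion[of \<alpha> \<rho> m] \<alpha>_bounds \<rho>_gt_1 z_rest[OF assms(1)] assms(2) by simp

lemma z_le_at_rest:
  assumes "u \<in> rest" "u' \<in> verts G" "depth u = Suc (depth u')"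
  shows "\<rho> * z u \<le> alpha_sum \<alpha> z u {u'}"
  unfolding alpha_sum_singleton z_rest_recursion[OF assms(1,3)]
  using \<alpha>_bounds power_depth_le_z[OF assms(2)] by (intro add_left_mono mult_left_mono) auto

lemma alpha_sum_le_A_alpha_op:
  "N \<subseteq> out_neighbours G u \<Longrightarrow> alpha_sum \<alpha> z u N \<le> A_alpha_op \<alpha> G z u"
  unfolding A_alpha_op_def using \<alpha>_bounds z_pos
  by (intro alpha_sum_mono_set) (auto intro: less_imp_le)

lemma subsolution_z: "subsolution \<alpha> \<rho> z"
proof -
  have "\<exists>N\<subseteq>out_neighbours G u. \<rho> * z u \<le> alpha_sum \<alpha> z u N" if "u \<in> verts G" for u
  proof -
    consider "u = v" | "u \<in> S" "u \<noteq> v" | "u \<in> T" | "u \<in> rest" using \<open>u \<in> verts G\<close> by blast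
    then show ?thesis
    proof cases
      case 1
      then show ?thesis using start_neighbours z_le_at_start by blast
    next
      case 2
      then show ?thesis using part_neighbours z_le_at_part by blast
    next
      case 3
      then show ?thesis using opposite_neighbours z_le_at_opposite by blast
    next
      case 4
      then obtain u' where u': "u' \<in> verts G" "u \<rightarrow> u'" "depth u = Suc (depth u')"
        by (rule depth_restE)
      then show ?thesis using z_le_at_rest[OF 4 u'(1,3)] by (intro exI[of _ "{u'}"]) auto
    qed
  qed
  then show ?thesis unfolding subsolution_def
    using alpha_sum_le_A_alpha_op z_pos order_trans by meson
qed

lemma verts_nonempty: "verts G \<noteq> {}"
  using w_rest by blast

lemma lambda_alpha_ge: "\<rho> \<le> lambda_alpha \<alpha> G"
  by (rule lambda_alpha_ge_subsolution[OF \<alpha>_bounds verts_nonempty subsolution_z])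

lemma lambda_alpha_gt:
  assumes "u \<in> verts G" "\<rho> * z u < A_alpha_op \<alpha> G z u"
  shows "\<rho> < lambda_alpha \<alpha> G"
  using \<rho>_gt_1
  by (intro lambda_alpha_gt_subsolution[OF \<alpha>_bounds strong _ subsolution_z assms]) simp

lemma lambda_alpha_gt_of_slack:
  assumes "(\<rho> - \<alpha> * card T - \<alpha>) * b < (1 - \<alpha>) * (card T * y + t ^ card rest)"
  shows "\<rho> < lambda_alpha \<alpha> G"
proof (rule lambda_alpha_gt)
  show "v \<in> verts G" using exit(1) S_verts by blast
  have "\<rho> * z v < alpha_sum \<alpha> z v (insert w T)"
    unfolding alpha_sum_z_start z_v using assms power_card_rest_le by (simp add: algebra_simps)
  also have "\<dots> \<le> A_alpha_op \<alpha> G z v" by (rule alpha_sum_le_A_alpha_op[OF start_neighbours])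
  finally show "\<rho> * z v < A_alpha_op \<alpha> G z v" .
qed

end

section \<open>The case of equality\<close>

lemma ex_bij_betw_endpoints:
  assumes S: "finite S" "a \<in> S" "c \<in> S" "a \<noteq> c"
  obtains g :: "'a \<Rightarrow> nat" where "bij_betw g S {1..card S}" "g a = 1" "g c = card S"
proof -
  have card: "2 \<le> card S" using card_mono[of S "{a, c}"] S by auto
  have "card (S - {a, c}) = card {2..card S - 1}" using S by (simp add: card_Diff_subset)
  then obtain h where h: "bij_betw h (S - {a, c}) {2..card S - 1}"
    using finite_same_card_bij[of "S - {a, c}" "{2..card S - 1}"] S(1) by auto
  define g where "g = (\<lambda>u. if u \<in> S - {a, c} then h u else if u = a then 1 else card S)"
  have "bij_betw (\<lambda>u. if u = a then 1 else card S) {a, c} {1, card S}"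
    using S(4) card by (auto simp: bij_betw_def)
  from bij_betw_disjoint_Un[OF h this]
  have "bij_betw g ((S - {a, c}) \<union> {a, c}) ({2..card S - 1} \<union> {1, card S})"
    unfolding g_def using card by auto
  moreover have "(S - {a, c}) \<union> {a, c} = S" "{2..card S - 1} \<union> {1, card S} = {1..card S}"
    using S card by auto
  ultimately show ?thesis using that[of g] S(4) by (simp add: g_def)
qed

locale extremal_biclique_exit =
  biclique_exit G S T v w + ear_solution \<alpha> \<rho> b y "card S" "card T" "card (verts G - (S \<union> T))"
  for G :: "('a,'b) pre_digraph" (structure) and S T v w \<alpha> \<rho> b y +
  assumes extremal: "lambda_alpha \<alpha> G = \<rho>"

sublocale extremal_biclique_exit \<subseteq> weighted_biclique_exit ..

context extremal_biclique_exit
begin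

lemma A_alpha_op_z: "u \<in> verts G \<Longrightarrow> A_alpha_op \<alpha> G z u = \<rho> * z u"
  using lambda_alpha_gt[of u] extremal subsolution_z by (fastforce simp: subsolution_def)

lemma tight_neighbours:
  assumes u: "u \<in> verts G" and N: "N \<subseteq> out_neighbours G u" "\<rho> * z u \<le> alpha_sum \<alpha> z u N"
  shows "out_neighbours G u = N" "alpha_sum \<alpha> z u N = \<rho> * z u"
proof -
  have "alpha_sum \<alpha> z u (out_neighbours G u) \<le> alpha_sum \<alpha> z u N"
    using A_alpha_op_z[OF u] N(2) by (simp add: A_alpha_op_def)
  then have "\<not> N \<subset> out_neighbours G u"
    using alpha_sum_strict_mono_set[of \<alpha> "out_neighbours G u" N z u] \<alpha>_bounds z_pos
    by (meson finite_out_neighbours less_imp_le not_le)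
  then show "out_neighbours G u = N" using N(1) by blast
  then show "alpha_sum \<alpha> z u N = \<rho> * z u" using A_alpha_op_z[OF u] by (simp add: A_alpha_op_def)
qed

lemma out_neighbours_start: "out_neighbours G v = insert w T"
  and depth_w: "depth w = card rest"
proof -
  have v: "v \<in> verts G" using exit(1) S_verts by blast
  note tight = tight_neighbours[OF v start_neighbours z_le_at_start]
  show "out_neighbours G v = insert w T" by (rule tight)
  have "(1 - \<alpha>) * t ^ depth w = (1 - \<alpha>) * t ^ card rest"
    using tight(2) at_start_eq unfolding alpha_sum_z_start z_v by (simp add: algebra_simps)
  then show "depth w = card rest" using \<alpha>_bounds t_pos t_less_1 by (simp add: power_inject_exp')
qed

lemma out_neighbours_part: "u \<in> S \<Longrightarrow> u \<noteq> v \<Longrightarrow> out_neighbours G u = T"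
  using tight_neighbours(1) part_neighbours z_le_at_part S_verts by blast

lemma out_neighbours_opposite: "u \<in> T \<Longrightarrow> out_neighbours G u = S"
  using tight_neighbours(1) opposite_neighbours z_le_at_opposite T_verts by blast

lemma out_neighbours_restE:
  assumes u: "u \<in> rest"
  obtains u' where "out_neighbours G u = {u'}" "depth u = Suc (depth u')" "u' \<in> S \<union> rest" "u' \<noteq> v"
proof -
  obtain u' where u': "u' \<in> verts G" "u \<rightarrow> u'" "depth u = Suc (depth u')"
    using depth_restE[OF u] .
  have N: "{u'} \<subseteq> out_neighbours G u" using u'(2) by blast
  note tight = tight_neighbours[OF _ N z_le_at_rest[OF u u'(1,3)]]
  have "(1 - \<alpha>) * z u' = (1 - \<alpha>) * t ^ depth u'"
    using tight(2) u z_rest_recursion[OF u u'(3)] by (simp add: alpha_sum_singleton)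
  then have z_u': "z u' = t ^ depth u'" using \<alpha>_bounds by simp
  have "u' \<notin> T" using z_u' z_T[of u'] depth_T[of u'] y_gt by auto
  moreover have "u' \<noteq> v" using z_u' z_v b_gt depth_eq_0_iff[OF u'(1)] exit(1) by auto
  ultimately show ?thesis using that[OF tight(1) u'(3)] u u'(1) by blast
qed

lemma bij_betw_depth: "bij_betw depth rest {1..card rest}"
proof -
  have "{1..card rest} \<subseteq> depth ` rest"
  proof
    fix j assume "j \<in> {1..card rest}"
    then have "1 \<le> j" "j \<le> card rest" by auto
    from this(2,1) show "j \<in> depth ` rest"
    proof (induction rule: inc_induct)
      case base
      then show ?case using w_rest depth_w by (metis imageI)
    next
      case (step m)
      then have "Suc m \<in> depth ` rest" by simp
      then obtain u where u: "u \<in> rest" "Suc m = depth u" by (rule imageE)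
      obtain u' where u': "depth u = Suc (depth u')" "u' \<in> S \<union> rest"
        using out_neighbours_restE[OF u(1)] by metis
      have "depth u' = m" using u(2) u'(1) by simp
      moreover from this have "u' \<notin> S"
        using depth_eq_0_iff[of u'] step.hyps step.prems S_verts by auto
      ultimately show ?case using u'(2) by blast
    qed
  qed
  then have image: "depth ` rest = {1..card rest}"
    using card_seteq[of "depth ` rest" "{1..card rest}"] card_image_le[of rest depth] by simp
  then have "inj_on depth rest" by (intro eq_card_imp_inj_on) simp_all
  with image show ?thesis by (simp add: bij_betw_def)
qed

lemma ear_returns:
  obtains v' where "v' \<in> S" "v' \<noteq> v"
    and "\<And>u. u \<in> rest \<Longrightarrow> depth u = 1 \<Longrightarrow> out_neighbours G u = {v'}"
proof -
  have "1 \<in> depth ` rest"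
    unfolding bij_betw_imp_surj_on[OF bij_betw_depth] using card_rest_pos by simp
  then obtain x where x: "x \<in> rest" "1 = depth x" by (rule imageE)
  obtain v' where v': "out_neighbours G x = {v'}" "depth x = Suc (depth v')"
    "v' \<in> S \<union> rest" "v' \<noteq> v"
    using out_neighbours_restE[OF x(1)] .
  have "v' \<in> S" using v' x(2) depth_eq_0_iff[of v'] S_verts by auto
  moreover have "u = x" if "u \<in> rest" "depth u = 1" for u
    using bij_betw_imp_inj_on[OF bij_betw_depth] that x by (auto dest: inj_onD)
  ultimately show ?thesis using that v' by blast
qed

definition B1_labelling :: "'a \<Rightarrow> ('a \<Rightarrow> nat) \<Rightarrow> bool" where
  "B1_labelling v' f \<longleftrightarrow> bij_betw f (verts G) {1..card (verts G)} \<and>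
    f ` S = {1..card S} \<and> f ` T = {card S + 1..card S + card T} \<and>
    f v = 1 \<and> f v' = card S \<and> (\<forall>u\<in>rest. f u = card (verts G) + 1 - depth u)"

lemma B1_labelling_exists:
  assumes v': "v' \<in> S" "v' \<noteq> v"
  obtains f where "B1_labelling v' f"
proof -
  let ?n = "card (verts G)" and ?p = "card S" and ?q = "card T"
  obtain g where g: "bij_betw g S {1..?p}" "g v = 1" "g v' = ?p"
    using ex_bij_betw_endpoints[OF finite_S exit(1) v'(1)] v'(2) by metis
  obtain h where h: "bij_betw h T {?p + 1..?p + ?q}"
    using finite_same_card_bij[of T "{?p + 1..?p + ?q}"] by auto
  define f where "f = (\<lambda>u. if u \<in> S then g u else if u \<in> T then h u else ?n + 1 - depth u)"
  have "bij_betw (\<lambda>i. ?n + 1 - i) {1..card rest} {?p + ?q + 1..?n}"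
    by (rule bij_betw_byWitness[where f' = "\<lambda>i. ?n + 1 - i"]) (auto simp: card_verts)
  from bij_betw_trans[OF bij_betw_depth this]
  have "bij_betw (\<lambda>u. ?n + 1 - depth u) rest {?p + ?q + 1..?n}" by (simp add: comp_def)
  from bij_betw_disjoint_Un[OF h this]
  have "bij_betw (\<lambda>u. if u \<in> T then h u else ?n + 1 - depth u) (T \<union> rest)
      ({?p + 1..?p + ?q} \<union> {?p + ?q + 1..?n})" by auto
  then have "bij_betw f (S \<union> (T \<union> rest)) ({1..?p} \<union> ({?p + 1..?p + ?q} \<union> {?p + ?q + 1..?n}))"
    unfolding f_def using disjoint by (intro bij_betw_disjoint_Un[OF g(1)]) auto
  moreover have "S \<union> (T \<union> rest) = verts G" using S_verts T_verts by blast
  moreover have "{1..?p} \<union> ({?p + 1..?p + ?q} \<union> {?p + ?q + 1..?n}) = {1..?n}"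
    by (auto simp: card_verts)
  ultimately have "bij_betw f (verts G) {1..?n}" by simp
  moreover have "f ` S = g ` S" "f ` T = h ` T"
    using disjoint by (intro image_cong; force simp: f_def)+
  ultimately have "B1_labelling v' f"
    using g h v'(1) exit(1) by (auto simp: B1_labelling_def f_def bij_betw_def)
  then show ?thesis by (rule that)
qed

lemma B1_labelling_ear_step:
  assumes f: "B1_labelling v' f" and u: "u \<in> rest" "depth u \<noteq> 1"
  shows "f ` out_neighbours G u = {Suc (f u)}"
    and "card S + card T < f u" "f u < card (verts G)"
proof -
  have f_rest: "f x = card (verts G) + 1 - depth x" if "x \<in> rest" for x
    using f that by (auto simp: B1_labelling_def)
  have range: "depth u \<in> {1..card rest}"
    using u(1) bij_betw_imp_surj_on[OF bij_betw_depth] by blast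
  obtain u' where u': "out_neighbours G u = {u'}" "depth u = Suc (depth u')" "u' \<in> S \<union> rest"
    using out_neighbours_restE[OF u(1)] by metis
  then have "u' \<in> rest" using u(2) depth_eq_0_iff[of u'] S_verts by auto
  then have "f u' = Suc (f u)" using f_rest[OF u(1)] f_rest[of u'] u'(2) range card_verts by simp
  then show "f ` out_neighbours G u = {Suc (f u)}" by (simp add: u'(1))
  show "card S + card T < f u" "f u < card (verts G)"
    using f_rest[OF u(1)] range u(2) card_verts by auto
qed

lemma B1_labelling_out_neighbours:
  assumes f: "B1_labelling v' f" and u: "u \<in> verts G"
    and last: "\<And>u. u \<in> rest \<Longrightarrow> depth u = 1 \<Longrightarrow> out_neighbours G u = {v'}"
    and card_S_ge_2: "2 \<le> card S"
  shows "f ` out_neighbours G u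
    = out_neighbours (with_proj (B1 (card (verts G)) (card S) (card T))) (f u)"
proof -
  let ?n = "card (verts G)" and ?p = "card S" and ?q = "card T"
  have bij: "bij_betw f (verts G) {1..?n}"
    and image: "f ` S = {1..?p}" "f ` T = {?p + 1..?p + ?q}"
    and ends: "f v = 1" "f v' = ?p" and f_rest: "\<And>u. u \<in> rest \<Longrightarrow> f u = ?n + 1 - depth u"
    using f by (auto simp: B1_labelling_def)
  note N = out_neighbours_B1[OF card_parts_less card_S_ge_2 card_T_pos]
  consider (start) "u = v" | (part) "u \<in> S" "u \<noteq> v" | (opposite) "u \<in> T"
    | (last) "u \<in> rest" "depth u = 1" | (ear) "u \<in> rest" "depth u \<noteq> 1"
    using u by blast
  then show ?thesis
  proof cases
    case start
    have "f w = ?p + ?q + 1" using f_rest[OF w_rest] depth_w card_verts by simp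
    then show ?thesis unfolding start out_neighbours_start ends(1) N(1) by (simp add: image)
  next
    case part
    have "f u \<in> {1..?p}" using part image by blast
    moreover have "f u \<noteq> f v"
      using part u exit(1) S_verts bij_betw_imp_inj_on[OF bij] by (auto dest: inj_onD)
    ultimately have "1 < f u" "f u \<le> ?p" by (auto simp: ends)
    from N(2)[OF this] show ?thesis unfolding out_neighbours_part[OF part] by (simp add: image)
  next
    case opposite
    then have "f u \<in> {?p + 1..?p + ?q}" using image by blast
    then have "?p < f u" "f u \<le> ?p + ?q" by auto
    from N(3)[OF this] show ?thesis
      unfolding out_neighbours_opposite[OF opposite] by (simp add: image)
  next
    case last
    have "f u = ?n" using f_rest[OF last(1)] last(2) by simp
    then show ?thesis unfolding assms(3)[OF last] by (simp add: N(5)[simplified] ends)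
  next
    case ear
    note step = B1_labelling_ear_step[OF f ear]
    show ?thesis unfolding step(1) N(4)[OF step(2,3)] ..
  qed
qed

lemma digraph_iso_B1: "digraph_iso G (with_proj (B1 (card (verts G)) (card S) (card T)))"
proof -
  obtain v' where v': "v' \<in> S" "v' \<noteq> v"
    and last: "\<And>u. u \<in> rest \<Longrightarrow> depth u = 1 \<Longrightarrow> out_neighbours G u = {v'}"
    using ear_returns by blast
  obtain f where f: "B1_labelling v' f" using B1_labelling_exists[OF v'] .
  have card_S_ge_2: "2 \<le> card S" using card_mono[of S "{v, v'}"] exit(1) v' by simp
  show ?thesis
  proof (rule digraph_isoI[OF digraph_axioms digraph_B1[OF card_parts_less card_S_ge_2 card_T_pos]])
    show "bij_betw f (verts G) (verts (with_proj (B1 (card (verts G)) (card S) (card T))))"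
      using f unfolding verts_B1[OF less_imp_le[OF card_parts_less]]
      by (simp add: B1_labelling_def)
  qed (use B1_labelling_out_neighbours[OF f _ last card_S_ge_2] in blast)
qed

end

section \<open>The minimum of the \<open>A\<^sub>\<alpha>\<close> spectral radius\<close>

lemma biclique_exit_of_bip_class:
  assumes G: "G \<in> bip_class n p q" and pq_bounds: "1 \<le> p" "1 \<le> q" "p + q < n"
    and parity: "\<not> [n = p + q] (mod 2)"
  obtains S T v w where "biclique_exit G S T v w" "card (verts G - (S \<union> T)) = n - (p + q)"
    and "card S = p \<and> card T = q \<or> card S = q \<and> card T = p"
proof -
  obtain H where digraph_G: "digraph G" and card_G: "card (verts G) = n"
    and strong: "strongly_connected G"
    and bipartite: "bipartite_digraph G" and H: "subgraph H G" "K\<^bsub>p,q\<^esub> H"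
    using G unfolding bip_class_def by blast
  interpret digraph G by (rule digraph_G)
  have odd: "odd (n - (p + q))" using parity pq_bounds(3) by (simp add: cong_altdef_nat)
  obtain U V where UV: "U \<inter> V = {}" "card U = p" "card V = q" "arcs_ends H = U \<times> V \<union> V \<times> U"
    using H(2) unfolding complete_bipartite_digraph_def by blast
  have arcs: "U \<times> V \<union> V \<times> U \<subseteq> arcs_ends G" using arcs_ends_mono[OF H(1)] UV(4) by simp
  have nonempty: "U \<noteq> {}" "V \<noteq> {}" and finite_parts: "finite U" "finite V"
    using UV pq_bounds card.infinite by force+
  have sub: "U \<union> V \<subseteq> verts G" using arcs nonempty adj_in_verts by blast
  have card_parts: "card (U \<union> V) = p + q" using finite_parts UV by (simp add: card_Un_disjoint)
  then have rest: "card (verts G - (U \<union> V)) = n - (p + q)"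
    using sub finite_parts card_G by (simp add: card_Diff_subset)
  have "U \<union> V \<subset> verts G" using sub card_parts card_G pq_bounds(3) by auto
  then obtain v w where vw: "v \<in> U \<union> V" "w \<notin> U \<union> V" "v \<rightarrow>\<^bsub>G\<^esub> w"
    using strongly_connected_exit[OF strong, of "U \<union> V"] nonempty by blast
  show ?thesis
  proof (cases "v \<in> U")
    case True
    have "biclique_exit G U V v w"
      by unfold_locales (use strong bipartite arcs nonempty odd rest vw True in auto)
    then show ?thesis using that rest UV by blast
  next
    case False
    have swap_parts: "V \<union> U = U \<union> V" "V \<times> U \<union> U \<times> V = U \<times> V \<union> V \<times> U" by auto
    have "biclique_exit G V U v w"
      by unfold_locales
        (use strong bipartite arcs nonempty odd rest vw False in \<open>auto simp: swap_parts\<close>)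
    then show ?thesis using that[of V U] rest UV by (simp add: swap_parts)
  qed
qed

lemma (in biclique_exit) lambda_alpha_ge_ear_solution:
  assumes "ear_solution \<alpha> \<rho> b y (card S) (card T) (card rest)"
  shows "\<rho> \<le> lambda_alpha \<alpha> G"
    and "lambda_alpha \<alpha> G = \<rho> \<Longrightarrow> digraph_iso G (with_proj (B1 (card (verts G)) (card S) (card T)))"
proof -
  interpret ear_solution \<alpha> \<rho> b y "card S" "card T" "card rest" by (rule assms)
  interpret weighted_biclique_exit G S T v w \<alpha> \<rho> b y ..
  show "\<rho> \<le> lambda_alpha \<alpha> G" by (rule lambda_alpha_ge)
  assume "lambda_alpha \<alpha> G = \<rho>"
  then interpret extremal_biclique_exit G S T v w \<alpha> \<rho> b y by unfold_locales
  show "digraph_iso G (with_proj (B1 (card (verts G)) (card S) (card T)))"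
    by (rule digraph_iso_B1)
qed

lemma (in biclique_exit) lambda_alpha_gt_ear_solution_of_smaller_part:
  assumes ear: "ear_solution \<alpha> \<rho> b y (card T) (card S) (card rest)" and less: "card S < card T"
  shows "\<rho> < lambda_alpha \<alpha> G"
proof -
  have "1 \<le> card S" using S_nonempty by (simp add: Suc_le_eq card_gt_0_iff)
  then obtain b' y' :: real where sub: "ear_subsolution \<alpha> \<rho> b' y' (card S) (card T) (card rest)"
    and slack: "(\<rho> - \<alpha> * card T - \<alpha>) * b' < (1 - \<alpha>) * (card T * y' + decay \<alpha> \<rho> ^ card rest)"
    using ear_solution.swapped_ear_subsolution[OF ear _ less] by metis
  interpret ear_subsolution \<alpha> \<rho> b' y' "card S" "card T" "card rest" by (rule sub)
  interpret weighted_biclique_exit G S T v w \<alpha> \<rho> b' y' ..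
  show ?thesis by (rule lambda_alpha_gt_of_slack[OF slack])
qed

theorem theorem4p10:
  fixes \<alpha> :: real and n p q :: nat and G :: "('a,'b) pre_digraph"
  assumes "0 \<le> \<alpha>" and "\<alpha> < 1"
    and "p \<ge> q" and "q \<ge> 2"
    and "p + q \<le> n - 1"
    and "\<not> [n = p + q] (mod 2)"
    and "G \<in> bip_class n p q"
  shows "lambda_alpha \<alpha> G \<ge> lambda_alpha \<alpha> (with_proj (B1 n p q)) \<and>
    (lambda_alpha \<alpha> G = lambda_alpha \<alpha> (with_proj (B1 n p q))
      \<longleftrightarrow> digraph_iso G (with_proj (B1 n p q)))"
proof -
  have pq_bounds: "p + q < n" "2 \<le> p" "1 \<le> p" "1 \<le> q" using assms(3-5) by auto
  have G: "digraph G" "card (verts G) = n" using assms(7) by (auto simp: bip_class_def)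
  obtain \<rho> b y where ear: "ear_solution \<alpha> \<rho> b y p q (n - (p + q))"
    using ear_solution_exists[OF assms(1,2) pq_bounds(3,4)] .
  have B1: "lambda_alpha \<alpha> (with_proj (B1 n p q)) = \<rho>"
    using ear_solution.lambda_alpha_B1[OF ear pq_bounds(2,4)] pq_bounds(1) by simp
  obtain S T v w where exit: "biclique_exit G S T v w"
    and rest: "card (verts G - (S \<union> T)) = n - (p + q)"
    and parts: "card S = p \<and> card T = q \<or> card S = q \<and> card T = p"
    using biclique_exit_of_bip_class[OF assms(7) pq_bounds(3,4,1) assms(6)] .
  consider "card S = p" "card T = q" | "card S < card T" "card S = q" "card T = p"
    using parts assms(3) by linarith
  then have "\<rho> \<le> lambda_alpha \<alpha> G \<and> (lambda_alpha \<alpha> G = \<rho> \<longrightarrow> digraph_iso G (with_proj (B1 n p q)))"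
    using biclique_exit.lambda_alpha_ge_ear_solution[OF exit]
      biclique_exit.lambda_alpha_gt_ear_solution_of_smaller_part[OF exit] ear rest G(2)
    by cases fastforce+
  then show ?thesis using lambda_alpha_iso[OF G(1)] B1 by metis
qed

end
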